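(* Let $A=\bigoplus_{r\in\mathbb Q}A_rX^r$ be an additive subgroup of $K[\mathbb Q,\sigma]$ with $A_0=V$, $W_r=O_l(A_r)$, $W=\bigcup_{r\in\mathbb Q}W_r$, where $W$ is a total valuation ring of $K$ with $W\supset V$ and $J(W)^2=J(W)$. Assume that there is a $t\in\mathbb Q$ with $O_l(A_t)=W$. Let $H=\{r\in\mathbb Q\mid {}^*(J(W)A_r)=Wc_r\text{ for some }c_r\in K\}$. Then $A$ is a graded extension of $V$ in $K[\mathbb Q,\sigma]$ of Type (h) if and only if there are elements $c_s\in K\setminus\{0\}$ $(s\in H)$ such that for all $r,s\in H$: ${}^*(J(W)A_s)=Wc_s$, $Wc_s=c_sW^{\sigma(s)}$, $Wc_{-s}=W(c_s^{-1})^{\sigma(-s)}$, $(Wc_r)(Wc_s)^{\sigma(r)}=Wc_{r+s}$, and the following properties hold: (1) $H$ is a nonzero proper additive subgroup of $\mathbb Q$, and $B=\bigoplus_{s\in H}A_sX^s$ is a graded extension of $V$ in $K[H,\sigma|_H]$. (2) For every $s\in\mathbb Q\setminus H$, ${}^*A_s=A_s=WA_s$ is not a principal left $W$-ideal and $O_r(A_s)=W^{\sigma(s)}$. (3) $M=\bigoplus_{r\in\mathbb Q}M_rX^r$ is a graded extension of $V$ in $K[\mathbb Q,\sigma]$, where $M_0=V$, $M_s=Wc_s$ for $s\in H$ with $s<0$, $M_s=J(W)c_s$ for $s\in H$ with $s>0$, and $M_r=A_r$ for $r\notin H$.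
   Context: $K$ is a division ring and $V$ is a total valuation ring of $K$ (a subring such that for every nonzero $k\in K$, $k\in V$ or $k^{-1}\in V$), with $V\neq K$. $\sigma:\mathbb Q\to \mathrm{Aut}(K)$ is a homomorphism from the additive group $\mathbb Q$. For $a\in K$, $I\subseteq K$, $g\in\mathbb Q$ write $a^{\sigma(g)}=\sigma(g)(a)$, $I^{\sigma(g)}=\sigma(g)(I)$. For a nonzero subgroup $G\subseteq\mathbb Q$, $K[G,\sigma]=\bigoplus_{g\in G}KX^g$ is the skew group ring, with $X^ga=a^{\sigma(g)}X^g$ and $X^gX^h=X^{g+h}$. A graded subring $A=\bigoplus_{g\in G}A_gX^g$ of $K[G,\sigma]$ is a graded total valuation ring if for every nonzero homogeneous element $aX^g$, $aX^g\in A$ or $(aX^g)^{-1}\in A$; it is a graded extension of $V$ in $K[G,\sigma]$ if moreover $A_0=V$. For $g>0$ in $\mathbb Q$, $K[X^g,X^{-g};\sigma(g)]$ denotes $K[\mathbb Zg,\sigma|_{\mathbb Zg}]$. Products of additive subgroups of $K$ are the additive subgroups generated by products of elements; $\supset$ denotes proper inclusion; $J(\cdot)$ denotes the Jacobson radical; $O_l(I)=\{a\in K\mid aI\subseteq I\}$, $O_r(I)=\{a\in K\mid Ia\subseteq I\}$. For a left $V$-ideal $I$ of $K$, ${}^*I=\bigcap\{Uc\mid I\subseteq Uc,\ c\in K\}$, where $U=O_l(I)$. A graded extension $\bigoplus_{g\in G}A_gX^g$ of $V$ in $K[G,\sigma]$ is of Type (II) if for some $g,h\in G$ with $g,h>0$,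 $A_gA_h^{\sigma(g)}\ne A_{g+h}$ or $A_{-g}(A_{-h})^{\sigma(-g)}\neq A_{-g-h}$. A graded extension $A=\bigoplus_{r\in\mathbb Q}A_rX^r$ of $V$ in $K[\mathbb Q,\sigma]$, with $W=\bigcup_{s\in\mathbb Q}O_l(A_s)$, is of Type (h) if there is a rational $r>0$ such that $\bigoplus_{i\in\mathbb Z}A_{ir}X^{ir}$ is a graded extension of $V$ of Type (II) in $K[X^r,X^{-r};\sigma(r)]$, and $J(W)^2=J(W)$. *)

theory Defs
  imports Complex_Main "HOL-Library.Poly_Mapping" "HOL-Computational_Algebra.Group_Closure"
begin

section \<open>Subgroups, products and one-sided ideals in a division ring\<close>

definition add_subgroup :: "'a::ab_group_add set \<Rightarrow> bool" where
  "add_subgroup S \<longleftrightarrow> 0 \<in> S \<and> (\<forall>x\<in>S. \<forall>y\<in>S. x - y \<in> S)"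

definition is_subring :: "'a::ring_1 set \<Rightarrow> bool" where
  "is_subring R \<longleftrightarrow> add_subgroup R \<and> 1 \<in> R \<and> (\<forall>x\<in>R. \<forall>y\<in>R. x * y \<in> R)"

definition total_valuation_ring :: "'a::division_ring set \<Rightarrow> bool" where
  "total_valuation_ring V \<longleftrightarrow> is_subring V \<and> (\<forall>k. k \<noteq> 0 \<longrightarrow> k \<in> V \<or> inverse k \<in> V)"

definition set_prod :: "'a::ring_1 set \<Rightarrow> 'a set \<Rightarrow> 'a set" (infixl "\<odot>" 70) where
  "I \<odot> J = group_closure {a * b | a b. a \<in> I \<and> b \<in> J}"

definition rmul :: "'a::ring_1 set \<Rightarrow> 'a \<Rightarrow> 'a set" where
  "rmul I c = {a * c | a. a \<in> I}"

definition lmul :: "'a::ring_1 \<Rightarrow> 'a set \<Rightarrow> 'a set" where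
  "lmul c I = {c * a | a. a \<in> I}"

definition left_order :: "'a::ring_1 set \<Rightarrow> 'a set" where
  "left_order I = {a. lmul a I \<subseteq> I}"

definition right_order :: "'a::ring_1 set \<Rightarrow> 'a set" where
  "right_order I = {a. rmul I a \<subseteq> I}"

definition star :: "'a::ring_1 set \<Rightarrow> 'a set" where
  "star I = \<Inter>{rmul (left_order I) c | c. I \<subseteq> rmul (left_order I) c}"

definition left_ideal :: "'a::ring_1 set \<Rightarrow> 'a set \<Rightarrow> bool" where
  "left_ideal R I \<longleftrightarrow> I \<subseteq> R \<and> add_subgroup I \<and> (\<forall>r\<in>R. \<forall>x\<in>I. r * x \<in> I)"

definition maximal_left_ideal :: "'a::ring_1 set \<Rightarrow> 'a set \<Rightarrow> bool" where
  "maximal_left_ideal R M \<longleftrightarrow> left_ideal R M \<and> M \<noteq> R \<and>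
     (\<forall>I. left_ideal R I \<and> M \<subseteq> I \<longrightarrow> I = M \<or> I = R)"

definition jacobson :: "'a::ring_1 set \<Rightarrow> 'a set" where
  "jacobson R = {x \<in> R. \<forall>M. maximal_left_ideal R M \<longrightarrow> x \<in> M}"

section \<open>Skew group rings over subgroups of the rationals\<close>

definition ring_automorphism :: "('a::ring_1 \<Rightarrow> 'a) \<Rightarrow> bool" where
  "ring_automorphism f \<longleftrightarrow> bij f \<and> f 1 = 1 \<and>
     (\<forall>x y. f (x + y) = f x + f y) \<and> (\<forall>x y. f (x * y) = f x * f y)"

definition aut_action :: "(rat \<Rightarrow> 'a::ring_1 \<Rightarrow> 'a) \<Rightarrow> bool" where
  "aut_action \<sigma> \<longleftrightarrow> (\<forall>g. ring_automorphism (\<sigma> g)) \<and> (\<forall>g h. \<sigma> (g + h) = \<sigma> g \<circ> \<sigma> h)"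

text \<open>
  An element of the skew group ring is a finitely supported function on the rationals;
  \<^term>\<open>Poly_Mapping.single g a\<close> stands for $a X^g$. The multiplication is
  $(a X^g)(b X^h) = a\, b^{\sigma(g)} X^{g+h}$, not the untwisted convolution that
  \<^theory>\<open>HOL-Library.Poly_Mapping\<close> provides as \<open>*\<close>.
\<close>

definition skew_mult ::
  "(rat \<Rightarrow> 'a::ring_1 \<Rightarrow> 'a) \<Rightarrow> (rat \<Rightarrow>\<^sub>0 'a) \<Rightarrow> (rat \<Rightarrow>\<^sub>0 'a) \<Rightarrow> (rat \<Rightarrow>\<^sub>0 'a)" where
  "skew_mult \<sigma> p q =
     (\<Sum>g\<in>Poly_Mapping.keys p. \<Sum>h\<in>Poly_Mapping.keys q.
        Poly_Mapping.single (g + h) (Poly_Mapping.lookup p g * \<sigma> g (Poly_Mapping.lookup q h)))"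

abbreviation skew_one :: "rat \<Rightarrow>\<^sub>0 'a::ring_1" where
  "skew_one \<equiv> Poly_Mapping.single 0 1"

definition skew_group_ring :: "rat set \<Rightarrow> (rat \<Rightarrow>\<^sub>0 'a::ring_1) set" where
  "skew_group_ring G = {p. Poly_Mapping.keys p \<subseteq> G}"

definition skew_subring ::
  "(rat \<Rightarrow> 'a::ring_1 \<Rightarrow> 'a) \<Rightarrow> rat set \<Rightarrow> (rat \<Rightarrow>\<^sub>0 'a) set \<Rightarrow> bool" where
  "skew_subring \<sigma> G S \<longleftrightarrow> S \<subseteq> skew_group_ring G \<and> add_subgroup S \<and> skew_one \<in> S \<and>
     (\<forall>x\<in>S. \<forall>y\<in>S. skew_mult \<sigma> x y \<in> S)"

text \<open>
  The subset $\bigoplus_{g \in G} A_g X^g$ of $K[G,\sigma]$; components of the family \<open>A\<close>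
  outside \<open>G\<close> are ignored.
\<close>

definition graded_sum :: "rat set \<Rightarrow> (rat \<Rightarrow> 'a::ring_1 set) \<Rightarrow> (rat \<Rightarrow>\<^sub>0 'a) set" where
  "graded_sum G A = {p \<in> skew_group_ring G. \<forall>g\<in>G. Poly_Mapping.lookup p g \<in> A g}"

definition graded_total_valuation_ring ::
  "(rat \<Rightarrow> 'a::division_ring \<Rightarrow> 'a) \<Rightarrow> rat set \<Rightarrow> (rat \<Rightarrow> 'a set) \<Rightarrow> bool" where
  "graded_total_valuation_ring \<sigma> G A \<longleftrightarrow> skew_subring \<sigma> G (graded_sum G A) \<and>
     (\<forall>g\<in>G. \<forall>a. a \<noteq> 0 \<longrightarrow>
        Poly_Mapping.single g a \<in> graded_sum G A \<or>
        (\<exists>y\<in>graded_sum G A. skew_mult \<sigma> (Poly_Mapping.single g a) y = skew_one \<and>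
                             skew_mult \<sigma> y (Poly_Mapping.single g a) = skew_one))"

definition graded_extension ::
  "(rat \<Rightarrow> 'a::division_ring \<Rightarrow> 'a) \<Rightarrow> 'a set \<Rightarrow> rat set \<Rightarrow> (rat \<Rightarrow> 'a set) \<Rightarrow> bool" where
  "graded_extension \<sigma> V G A \<longleftrightarrow> graded_total_valuation_ring \<sigma> G A \<and> A 0 = V"

definition graded_extension_type_II ::
  "(rat \<Rightarrow> 'a::division_ring \<Rightarrow> 'a) \<Rightarrow> 'a set \<Rightarrow> rat set \<Rightarrow> (rat \<Rightarrow> 'a set) \<Rightarrow> bool" where
  "graded_extension_type_II \<sigma> V G A \<longleftrightarrow> graded_extension \<sigma> V G A \<and>
     (\<exists>g\<in>G. \<exists>h\<in>G. g > 0 \<and> h > 0 \<and>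
        (A g \<odot> \<sigma> g ` A h \<noteq> A (g + h) \<or>
         A (- g) \<odot> \<sigma> (- g) ` A (- h) \<noteq> A (- g - h)))"

definition graded_extension_type_h ::
  "(rat \<Rightarrow> 'a::division_ring \<Rightarrow> 'a) \<Rightarrow> 'a set \<Rightarrow> (rat \<Rightarrow> 'a set) \<Rightarrow> bool" where
  "graded_extension_type_h \<sigma> V A \<longleftrightarrow> graded_extension \<sigma> V UNIV A \<and>
     (\<exists>r>0. graded_extension_type_II \<sigma> V (range (\<lambda>i::int. of_int i * r)) A) \<and>
     (let J = jacobson (\<Union>s. left_order (A s)) in J \<odot> J = J)"

section \<open>Basic facts about the skew multiplication\<close>

lemma aut_action_zero: "aut_action \<sigma> \<Longrightarrow> \<sigma> g 0 = 0"
  unfolding aut_action_def ring_automorphism_def by (metis add_cancel_right_right)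

lemma aut_action_0: assumes "aut_action \<sigma>" shows "\<sigma> 0 a = a"
proof -
  have "\<sigma> 0 (\<sigma> 0 a) = \<sigma> 0 a" "inj (\<sigma> 0)"
    using assms unfolding aut_action_def ring_automorphism_def bij_def
    by (metis add_0 comp_apply, blast)
  thus ?thesis by (simp add: inj_eq)
qed

lemma skew_mult_single:
  assumes "aut_action \<sigma>"
  shows "skew_mult \<sigma> (Poly_Mapping.single g a) (Poly_Mapping.single h b) =
         Poly_Mapping.single (g + h) (a * \<sigma> g b)"
  using aut_action_zero[OF assms] by (simp add: skew_mult_def)

lemma skew_mult_superset:
  assumes \<sigma>: "aut_action \<sigma>" and "finite S" "finite T"
    and "Poly_Mapping.keys p \<subseteq> S" "Poly_Mapping.keys q \<subseteq> T"
  shows "skew_mult \<sigma> p q =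
     (\<Sum>g\<in>S. \<Sum>h\<in>T.
        Poly_Mapping.single (g + h) (Poly_Mapping.lookup p g * \<sigma> g (Poly_Mapping.lookup q h)))"
proof -
  have "skew_mult \<sigma> p q = (\<Sum>g\<in>S. \<Sum>h\<in>Poly_Mapping.keys q.
        Poly_Mapping.single (g + h) (Poly_Mapping.lookup p g * \<sigma> g (Poly_Mapping.lookup q h)))"
    unfolding skew_mult_def using assms(2-4) by (intro sum.mono_neutral_left) (auto simp: in_keys_iff)
  also have "\<dots> = (\<Sum>g\<in>S. \<Sum>h\<in>T.
        Poly_Mapping.single (g + h) (Poly_Mapping.lookup p g * \<sigma> g (Poly_Mapping.lookup q h)))"
    using assms aut_action_zero[OF \<sigma>]
    by (intro sum.cong refl sum.mono_neutral_left) (auto simp: in_keys_iff)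
  finally show ?thesis .
qed

lemma skew_mult_add_left:
  assumes \<sigma>: "aut_action \<sigma>"
  shows "skew_mult \<sigma> (p + p') q = skew_mult \<sigma> p q + skew_mult \<sigma> p' q"
proof -
  let ?S = "Poly_Mapping.keys p \<union> Poly_Mapping.keys p'"
  show ?thesis
    using keys_add[of p p']
    by (simp add: skew_mult_superset[OF \<sigma>, of ?S "Poly_Mapping.keys q"] lookup_add
        distrib_right single_add sum.distrib)
qed

lemma skew_mult_add_right:
  assumes \<sigma>: "aut_action \<sigma>"
  shows "skew_mult \<sigma> p (q + q') = skew_mult \<sigma> p q + skew_mult \<sigma> p q'"
proof -
  let ?T = "Poly_Mapping.keys q \<union> Poly_Mapping.keys q'"
  have "\<sigma> g (a + b) = \<sigma> g a + \<sigma> g b" for g a b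
    using \<sigma> by (auto simp: aut_action_def ring_automorphism_def)
  thus ?thesis
    using keys_add[of q q']
    by (simp add: skew_mult_superset[OF \<sigma>, of "Poly_Mapping.keys p" ?T] lookup_add
        distrib_left single_add sum.distrib)
qed

lemma skew_mult_assoc:
  assumes \<sigma>: "aut_action \<sigma>"
  shows "skew_mult \<sigma> (skew_mult \<sigma> p q) r = skew_mult \<sigma> p (skew_mult \<sigma> q r)"
proof -
  have zero: "skew_mult \<sigma> 0 q = 0" "skew_mult \<sigma> q 0 = 0" for q
    by (simp_all add: skew_mult_def)
  have ind: "P p" if "P 0" "\<And>a b. P a \<Longrightarrow> P b \<Longrightarrow> P (a + b)" "\<And>g a. P (Poly_Mapping.single g a)"
    for P and p :: "rat \<Rightarrow>\<^sub>0 'a"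
  proof -
    have "P (\<Sum>g\<in>S. Poly_Mapping.single g (Poly_Mapping.lookup p g))" if "finite S" for S
      using that by (induction S) (auto intro: \<open>P 0\<close> \<open>\<And>a b. P a \<Longrightarrow> P b \<Longrightarrow> P (a + b)\<close>
          \<open>\<And>g a. P (Poly_Mapping.single g a)\<close>)
    moreover have "(\<Sum>g\<in>Poly_Mapping.keys p. Poly_Mapping.single g (Poly_Mapping.lookup p g)) = p"
      by (intro poly_mapping_eqI)
        (auto simp: lookup_sum lookup_single when_def in_keys_iff)
    ultimately show ?thesis using finite_keys[of p] by metis
  qed
  have mult: "\<sigma> g (a * b) = \<sigma> g a * \<sigma> g b" and comp: "\<sigma> (g + h) a = \<sigma> g (\<sigma> h a)" for g h a b
    using \<sigma> by (auto simp: aut_action_def ring_automorphism_def)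
  show ?thesis
  proof (induction p rule: ind)
    case (3 g a) show ?case
    proof (induction q rule: ind)
      case (3 h b) show ?case
        by (induction r rule: ind)
          (simp_all add: zero skew_mult_add_left[OF \<sigma>] skew_mult_add_right[OF \<sigma>]
            skew_mult_single[OF \<sigma>] mult comp mult.assoc add.assoc)
    qed (simp_all add: zero skew_mult_add_left[OF \<sigma>] skew_mult_add_right[OF \<sigma>])
  qed (simp_all add: zero skew_mult_add_left[OF \<sigma>])
qed

end

theory Submission
  imports Defs
begin

text \<open>
  Apart from additivity of the components, everything in the statement is multiplicative. The nonzero
  homogeneous elements $a X^r$ form a group graded by the rationals, and a graded extension becomes a
  cone in it: a multiplicatively closed set $P$ that contains $x$ or $x^{-1}$ for every $x$. One-sided
  modules over a total valuation ring are unions of chains of principal ones, so that inclusions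
  between products of modules can be tested on products of elements. The radical $J = J(W)$ consists of
  the nonunits of $W$, and $J^2 = J$ is used through its consequence that $J$ is not a principal left
  $W$-module.

  The decisive notion is that of a sandwiched element: $g = c X^r$ with $J c \<subseteq> A_r \<subseteq> W c$. When
  $W \<noteq> K$, the degree $r$ belongs to $H$ exactly if it carries such an element (\<open>star_sandwich\<close>,
  \<open>sandwich_of_star\<close>). An element $x$ missing from $A_r$ bounds it, $A_r \<subseteq> V x$. Hence a component that is
  not a $W$-module, or is principal, or is not an intersection of principal $W$-modules, has a sandwiched
  element in its degree (\<open>W_stable\<close>, \<open>not_principal\<close>, \<open>intersection_of_principal\<close>); this is
  property (2).

  In the degrees of $H$ the point is that sandwiched elements normalise $W$ (\<open>conj_W\<close>): otherwise some
  component would have a left stabiliser that is not contained in $W$. They are therefore closed under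
  products and inverses, $H$ is a subgroup, and the relations between the $c_s$ follow. Type (II)
  excludes the extreme subgroups: $A_a A_b^{\<sigma>(a)} = A_{a+b}$ always holds for $a + b$ outside $H$
  (\<open>product_decomposition\<close>), and for $H = Q$ it holds for all $a$, $b$ of equal sign because a
  component with left order $W$ forces every component to be $W c_s$ or $J c_s$
  (\<open>product_decomposition_if_all_sandwiched\<close>).

  The families $A$ and $M$ agree off $H$ and are both sandwiched on $H$. A component off $H$ is not
  principal and so absorbs $J$; therefore products with a factor off $H$ do not notice the
  difference, and one family is a graded extension as soon as the other is and the first one is
  so on $H$ (\<open>cone_transfer\<close>). This gives (3) in one direction and the ring structure of $A$ in the
  other. For the converse it remains to see Type (II): if $s = a + b$ is in $H$ but $a$, $b$ are not, then
  $A_a A_b^{\<sigma>(a)} \<subseteq> J c_s$, and $A_s$, $A_{-s}$ are not both of this size.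
\<close>

section \<open>Groups graded by the rationals over a total submonoid\<close>

text \<open>
  The model is the group of nonzero homogeneous elements $a X^r$, with $W$ the set of nonzero
  elements of a total valuation ring, placed in degree $0$. The last axiom is what
  $J(W)^2 = J(W)$ amounts to multiplicatively: the radical is not a principal left $W$-module.
  It holds vacuously when $W$ is everything in degree $0$.
\<close>

locale valued_group = group mult one inv
  for mult :: "'g \<Rightarrow> 'g \<Rightarrow> 'g" (infixl "\<cdot>" 70)
    and one :: 'g ("\<one>") and inv :: "'g \<Rightarrow> 'g" ("_\<^sup>-" [1000] 999) +
  fixes deg :: "'g \<Rightarrow> rat" and W :: "'g set"
  assumes deg_mult [simp]: "deg (x \<cdot> y) = deg x + deg y"
    and deg_W: "w \<in> W \<Longrightarrow> deg w = 0"
    and mult_W: "v \<in> W \<Longrightarrow> w \<in> W \<Longrightarrow> v \<cdot> w \<in> W"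
    and total_W: "deg x = 0 \<Longrightarrow> x \<in> W \<or> x\<^sup>- \<in> W"
    and rad_not_principal: "j \<in> W \<Longrightarrow> j\<^sup>- \<notin> W \<Longrightarrow> \<exists>k\<in>W. k\<^sup>- \<notin> W \<and> k \<cdot> j\<^sup>- \<notin> W"
begin

declare assoc [simp] inverse_distrib_swap [simp]

lemma cancel [simp]: "x\<^sup>- \<cdot> (x \<cdot> y) = y" "x \<cdot> (x\<^sup>- \<cdot> y) = y"
  by (simp_all flip: assoc)

lemma deg_one [simp]: "deg \<one> = 0"
  using deg_mult[of \<one> \<one>] by simp

lemma deg_inv [simp]: "deg (x\<^sup>-) = - deg x"
  using deg_mult[of x "x\<^sup>-"] by simp

lemma one_W [simp]: "\<one> \<in> W"
  using total_W[of \<one>] by simp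

definition rad :: "'g set" where "rad = {x. deg x = 0 \<and> x\<^sup>- \<notin> W}"

lemma rad_W: "j \<in> rad \<Longrightarrow> j \<in> W"
  using total_W by (auto simp: rad_def)

lemma rad_deg: "j \<in> rad \<Longrightarrow> deg j = 0"
  by (simp add: rad_def)

lemma W_mult_rad: "w \<in> W \<Longrightarrow> j \<in> rad \<Longrightarrow> w \<cdot> j \<in> rad"
  using mult_W[of "j\<^sup>- \<cdot> w\<^sup>-" w] by (auto simp: rad_def deg_W)

lemma rad_mult_W: "j \<in> rad \<Longrightarrow> w \<in> W \<Longrightarrow> j \<cdot> w \<in> rad"
  using mult_W[of w "w\<^sup>- \<cdot> j\<^sup>-"] by (auto simp: rad_def deg_W)

text \<open>
  Pick $l$ in the radical with $j \<in> J(W)\, l$; then $j l^{-1}$ is the other factor.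
\<close>

lemma rad_factor:
  assumes "j \<in> rad" obtains k l where "k \<in> rad" "l \<in> rad" "j = k \<cdot> l"
proof -
  from rad_not_principal[of j] assms rad_W[OF assms] obtain l
    where l: "l \<in> W" "l\<^sup>- \<notin> W" "l \<cdot> j\<^sup>- \<notin> W" by (auto simp: rad_def)
  then have "j \<cdot> l\<^sup>- \<in> rad" "l \<in> rad" using assms by (auto simp: rad_def deg_W)
  moreover have "j = (j \<cdot> l\<^sup>-) \<cdot> l" by simp
  ultimately show ?thesis using that by blast
qed

text \<open>
  If $z \<notin> W$, then $z^{-1}$ lies in the radical and $J(W) \<subseteq> W z^{-1}$ would make the radical
  principal. This is how a product with the radical is cancelled everywhere below.
\<close>

lemma rad_test:
  assumes "deg z = 0" "\<And>k. k \<in> rad \<Longrightarrow> k \<cdot> z \<in> W" shows "z \<in> W"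
proof (rule ccontr)
  assume z: "z \<notin> W"
  then have "z\<^sup>- \<in> rad" using assms by (simp add: rad_def)
  then obtain k where "k \<in> W" "k\<^sup>- \<notin> W" "k \<cdot> z \<notin> W"
    using rad_not_principal[of "z\<^sup>-"] rad_W z by auto
  with assms(2)[of k] show False by (simp add: rad_def deg_W)
qed

text \<open>
  Equality of the principal left $W$-modules $W x$ and $W y$.
\<close>

definition assoc_eq :: "'g \<Rightarrow> 'g \<Rightarrow> bool" (infix "\<approx>" 50) where
  "x \<approx> y \<longleftrightarrow> x \<cdot> y\<^sup>- \<in> W \<and> y \<cdot> x\<^sup>- \<in> W"

definition normalizes_W :: "'g \<Rightarrow> bool" where
  "normalizes_W g \<longleftrightarrow> (\<forall>u\<in>W. g \<cdot> u \<cdot> g\<^sup>- \<in> W \<and> g\<^sup>- \<cdot> u \<cdot> g \<in> W)"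

lemma normalizes_rad:
  assumes "normalizes_W g" "j \<in> rad"
  shows "g \<cdot> j \<cdot> g\<^sup>- \<in> rad" "g\<^sup>- \<cdot> j \<cdot> g \<in> rad"
  using assms(1)[unfolded normalizes_W_def, rule_format, of "g \<cdot> j\<^sup>- \<cdot> g\<^sup>-"]
    assms(1)[unfolded normalizes_W_def, rule_format, of "g\<^sup>- \<cdot> j\<^sup>- \<cdot> g"] assms(2)
  by (auto simp: rad_def)

text \<open>
  $J(W) g \<subseteq> P_r \<subseteq> W g$, where $P_r$ is the part of $P$ in the degree $r$ of $g$.
\<close>

definition sandwich :: "'g set \<Rightarrow> 'g \<Rightarrow> bool" where
  "sandwich P g \<longleftrightarrow> (\<forall>j\<in>rad. j \<cdot> g \<in> P) \<and> (\<forall>x\<in>P. deg x = deg g \<longrightarrow> x \<cdot> g\<^sup>- \<in> W)"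

text \<open>
  Totality turns upper bounds into lower ones: an element $j g$ with $j \<in> J(W)$ that is missing from $Q$
  has its inverse $g^{-1} j^{-1}$ in $Q$, and the upper bound in the opposite degree then puts
  $j^{-1}$ into $W$.
\<close>

lemma sandwich_if_total:
  assumes total: "\<And>x. deg x = deg g \<Longrightarrow> x \<in> Q \<or> x\<^sup>- \<in> Q"
    and g: "normalizes_W g" "\<And>x. x \<in> Q \<Longrightarrow> deg x = deg g \<Longrightarrow> x \<cdot> g\<^sup>- \<in> W"
    and h: "h \<cdot> g \<in> W" "\<And>x. x \<in> Q \<Longrightarrow> deg x = - deg g \<Longrightarrow> x \<cdot> h\<^sup>- \<in> W"
  shows "sandwich Q g"
  unfolding sandwich_def
proof (intro conjI ballI impI)
  fix j assume j: "j \<in> rad"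
  show "j \<cdot> g \<in> Q"
  proof (rule ccontr)
    assume "j \<cdot> g \<notin> Q"
    then have "g\<^sup>- \<cdot> j\<^sup>- \<in> Q" using total[of "j \<cdot> g"] j by (simp add: rad_deg)
    then have "g\<^sup>- \<cdot> j\<^sup>- \<cdot> h\<^sup>- \<in> W" using h(2)[of "g\<^sup>- \<cdot> j\<^sup>-"] j rad_deg by simp
    from mult_W[OF this h(1)] have "g\<^sup>- \<cdot> j\<^sup>- \<cdot> g \<in> W" by simp
    then have "g \<cdot> (g\<^sup>- \<cdot> j\<^sup>- \<cdot> g) \<cdot> g\<^sup>- \<in> W" using g(1) unfolding normalizes_W_def by blast
    then show False using j by (simp add: rad_def)
  qed
qed (use g(2) in auto)

text \<open>
  If $x y$ generated $W g$, then $x' y \<in> W g = W x y$ would give $x' \<in> W x$ for every $x'$ in the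
  component of $x$, against the choice of $x'$.
\<close>

lemma product_in_rad:
  assumes mult: "\<And>x y. x \<in> P \<Longrightarrow> y \<in> P \<Longrightarrow> x \<cdot> y \<in> P"
    and g: "sandwich P g" "deg g = deg x + deg y"
    and x: "x \<in> P" "\<exists>x'\<in>P. deg x' = deg x \<and> x' \<cdot> x\<^sup>- \<notin> W" and y: "y \<in> P"
  shows "x \<cdot> y \<cdot> g\<^sup>- \<in> rad"
proof (rule ccontr)
  assume "x \<cdot> y \<cdot> g\<^sup>- \<notin> rad"
  then have 1: "g \<cdot> y\<^sup>- \<cdot> x\<^sup>- \<in> W" using g by (simp add: rad_def)
  obtain x' where x': "x' \<in> P" "deg x' = deg x" "x' \<cdot> x\<^sup>- \<notin> W" using x by blast
  have "x' \<cdot> y \<cdot> g\<^sup>- \<in> W" using mult[OF x'(1) y] g x' by (auto simp: sandwich_def simp del: assoc)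
  from mult_W[OF this 1] x' show False by simp
qed

text \<open>
  Two sets $P$ and $Q$ that agree off $H$ and are both sandwiched on $H$ cannot be told apart by a product
  with a factor off $H$. Indeed a component $P_s$ with $s \<notin> H$ is a nonprincipal $W$-module, so
  $J(W) P_s = P_s$, and it makes no difference whether it is multiplied by $J(W) g_r$ or by $W g_r$; and
  a product of two components off $H$ that lands in a degree of $H$ stays inside $J(W) g$.
  The lemma serves both directions of the theorem, with the roles of the given family and its
  companion exchanged.
\<close>

lemma cone_transfer:
  assumes H: "add_subgroup H"
    and mult_P: "\<And>x y. x \<in> P \<Longrightarrow> y \<in> P \<Longrightarrow> x \<cdot> y \<in> P"
    and total_P: "\<And>x. x \<in> P \<or> x\<^sup>- \<in> P"
    and degree_0: "\<And>x. x \<in> P \<Longrightarrow> deg x = 0 \<Longrightarrow> x \<in> W"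
    and g: "\<And>s. s \<in> H \<Longrightarrow> deg (g s) = s \<and> normalizes_W (g s) \<and> sandwich P (g s) \<and> sandwich Q (g s)"
    and off_H: "\<And>x. deg x \<notin> H \<Longrightarrow> x \<in> Q \<longleftrightarrow> x \<in> P"
    and stable: "\<And>x w. x \<in> P \<Longrightarrow> deg x \<notin> H \<Longrightarrow> w \<in> W \<Longrightarrow> w \<cdot> x \<in> P \<and> x \<cdot> w \<in> P"
    and not_principal: "\<And>x. x \<in> P \<Longrightarrow> deg x \<notin> H \<Longrightarrow> \<exists>x'\<in>P. deg x' = deg x \<and> x' \<cdot> x\<^sup>- \<notin> W"
    and mult_Q: "\<And>x y. x \<in> Q \<Longrightarrow> y \<in> Q \<Longrightarrow> deg x \<in> H \<Longrightarrow> deg y \<in> H \<Longrightarrow> x \<cdot> y \<in> Q"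
    and total_Q: "\<And>x. deg x \<in> H \<Longrightarrow> x \<in> Q \<or> x\<^sup>- \<in> Q"
  shows "x \<in> Q \<Longrightarrow> y \<in> Q \<Longrightarrow> x \<cdot> y \<in> Q" and "x \<in> Q \<or> x\<^sup>- \<in> Q"
proof -
  have H_diff: "r - s \<in> H" if "r \<in> H" "s \<in> H" for r s using H that by (simp add: add_subgroup_def)
  have H_minus: "- r \<in> H \<longleftrightarrow> r \<in> H" for r
    using H_diff[of 0 r] H_diff[of 0 "-r"] H by (auto simp: add_subgroup_def)
  have H_add: "r + s \<in> H \<longleftrightarrow> s \<in> H" if "r \<in> H" for r s
    using H_diff[of s "-r"] H_diff[of "r + s" r] that H_minus by (auto simp: add.commute)
  have left: "g r \<cdot> y \<in> P" if r: "r \<in> H" and y: "y \<in> P" "deg y \<notin> H" for r y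
  proof -
    obtain y' where y': "y' \<in> P" "deg y' = deg y" "y' \<cdot> y\<^sup>- \<notin> W" using not_principal y by blast
    then have "y \<cdot> y'\<^sup>- \<in> rad" by (simp add: rad_def)
    then have "g r \<cdot> (y \<cdot> y'\<^sup>-) \<cdot> (g r)\<^sup>- \<in> rad" using normalizes_rad g r by blast
    then have "g r \<cdot> (y \<cdot> y'\<^sup>-) \<cdot> (g r)\<^sup>- \<cdot> g r \<in> P" using g[OF r] unfolding sandwich_def by blast
    from mult_P[OF this y'(1)] show ?thesis by simp
  qed
  have right: "x \<cdot> g s \<in> P" if s: "s \<in> H" and x: "x \<in> P" "deg x \<notin> H" for s x
  proof (rule ccontr)
    assume "x \<cdot> g s \<notin> P"
    then have "(g s)\<^sup>- \<cdot> x\<^sup>- \<in> P" using total_P[of "x \<cdot> g s"] by simp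
    from left[OF s this] have inv: "x\<^sup>- \<in> P"
      using g[OF s] H_add[of "- s" "- deg x"] H_minus s x by simp
    obtain x' where "x' \<in> P" "deg x' = deg x" "x' \<cdot> x\<^sup>- \<notin> W" using not_principal x by blast
    then show False using degree_0[OF mult_P[OF _ inv]] by simp
  qed
  have Q_W: "x \<cdot> (g (deg x))\<^sup>- \<in> W" if "x \<in> Q" "deg x \<in> H" for x
    using g that unfolding sandwich_def by metis
  show "x \<cdot> y \<in> Q" if x: "x \<in> Q" and y: "y \<in> Q"
  proof (cases "deg x \<in> H"; cases "deg y \<in> H")
    assume "deg x \<in> H" "deg y \<in> H"
    then show ?thesis using mult_Q x y by blast
  next
    assume *: "deg x \<in> H" "deg y \<notin> H"
    then have "deg (x \<cdot> y) \<notin> H" using H_add by simp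
    moreover have "(x \<cdot> (g (deg x))\<^sup>-) \<cdot> (g (deg x) \<cdot> y) \<in> P"
      using stable[OF left[of "deg x" y] _ Q_W[OF x]] * off_H y g H_add by auto
    ultimately show ?thesis using off_H by simp
  next
    assume *: "deg x \<notin> H" "deg y \<in> H"
    let ?w = "y \<cdot> (g (deg y))\<^sup>-"
    have n: "deg (x \<cdot> y) \<notin> H" using * H_add[of "deg y" "deg x"] by (simp add: add.commute)
    have w: "?w \<in> W" using Q_W y * by blast
    have "x \<cdot> ?w \<in> P" using stable[OF _ _ w] x * off_H by blast
    from right[OF *(2) this] have "x \<cdot> y \<in> P" using * deg_W[OF w] by simp
    with n show ?thesis using off_H by blast
  next
    assume *: "deg x \<notin> H" "deg y \<notin> H"
    then have xy: "x \<in> P" "y \<in> P" using off_H x y by auto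
    show ?thesis
    proof (cases "deg x + deg y \<in> H")
      case True
      then have "x \<cdot> y \<cdot> (g (deg x + deg y))\<^sup>- \<in> rad"
        using product_in_rad[OF mult_P _ _ xy(1) not_principal[OF xy(1) *(1)] xy(2)] g by metis
      then have "x \<cdot> y \<cdot> (g (deg x + deg y))\<^sup>- \<cdot> g (deg x + deg y) \<in> Q"
        using g[OF True] unfolding sandwich_def by blast
      then show ?thesis by simp
    qed (use off_H[of "x \<cdot> y"] mult_P[OF xy] in simp)
  qed
  show "x \<in> Q \<or> x\<^sup>- \<in> Q"
    using total_Q[of x] total_P[of x] off_H[of x] off_H[of "x\<^sup>-"] H_minus[of "deg x"] by auto
qed

text \<open>
  The set of homogeneous elements of the ring $M$ of the theorem: on the nonzero degrees of $H$ the
  components are replaced by the two extreme choices, $W g_r$ for $r < 0$ and $J(W) g_r$ for $r > 0$.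
\<close>

definition companion :: "rat set \<Rightarrow> (rat \<Rightarrow> 'g) \<Rightarrow> 'g set \<Rightarrow> 'g set" where
  "companion H g P = {x. if deg x \<noteq> 0 \<and> deg x \<in> H
     then x \<cdot> (g (deg x))\<^sup>- \<in> (if deg x < 0 then W else rad) else x \<in> P}"

lemma companion_sandwich:
  assumes "sandwich P (g s)" "deg (g s) = s" "s \<in> H"
  shows "sandwich (companion H g P) (g s)"
  using assms by (auto simp: sandwich_def companion_def rad_deg rad_W split: if_splits)

end

section \<open>Cones and sandwiched degrees\<close>

text \<open>
  A cone is the multiplicative trace of a graded total valuation ring. Its part in degree $0$ is the
  smaller valuation ring $V$, which is properly contained in $W$.
\<close>

locale cone = valued_group +
  fixes P :: "'a set"
  assumes mult_P: "x \<in> P \<Longrightarrow> y \<in> P \<Longrightarrow> x \<cdot> y \<in> P"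
    and total_P: "x \<in> P \<or> x\<^sup>- \<in> P"
    and P_degree_0: "x \<in> P \<Longrightarrow> deg x = 0 \<Longrightarrow> x \<in> W"
    and not_W_subset_P: "\<not> W \<subseteq> P"
begin

abbreviation sandwiched :: "'a \<Rightarrow> bool" where "sandwiched \<equiv> sandwich P"

lemma sandwiched_iff:
  "sandwiched g \<longleftrightarrow> (\<forall>x. deg x = deg g \<longrightarrow> g \<cdot> x\<^sup>- \<notin> W \<longrightarrow> x \<in> P) \<and>
     (\<forall>x\<in>P. deg x = deg g \<longrightarrow> x \<cdot> g\<^sup>- \<in> W)" (is "_ \<longleftrightarrow> ?R \<and> _")
proof -
  have "(\<forall>j\<in>rad. j \<cdot> g \<in> P) \<longleftrightarrow> ?R"
  proof (intro iffI allI impI ballI)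
    fix x assume *: "\<forall>j\<in>rad. j \<cdot> g \<in> P" and x: "deg x = deg g" "g \<cdot> x\<^sup>- \<notin> W"
    then have "x \<cdot> g\<^sup>- \<in> rad" by (simp add: rad_def)
    with * have "x \<cdot> g\<^sup>- \<cdot> g \<in> P" by blast
    then show "x \<in> P" by simp
  qed (simp add: rad_def)
  then show ?thesis by (simp add: sandwich_def)
qed

lemma sandwiched_lower: "sandwiched g \<Longrightarrow> deg x = deg g \<Longrightarrow> g \<cdot> x\<^sup>- \<notin> W \<Longrightarrow> x \<in> P"
  by (simp add: sandwiched_iff)

lemma sandwiched_rad: "sandwiched g \<Longrightarrow> j \<in> rad \<Longrightarrow> j \<cdot> g \<in> P"
  using sandwiched_lower[of g "j \<cdot> g"] by (simp add: rad_def)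

lemma sandwiched_upper: "sandwiched g \<Longrightarrow> x \<in> P \<Longrightarrow> deg x = deg g \<Longrightarrow> x \<cdot> g\<^sup>- \<in> W"
  by (simp add: sandwiched_iff)

text \<open>
  For the cone of a graded extension this is the set $H$ of the theorem, provided that $W$ is not the
  whole division ring.
\<close>

definition sandwich_degrees :: "rat set" where
  "sandwich_degrees = deg ` {g. sandwiched g}"

text \<open>
  In a fixed degree, a missing element $x$ bounds the component: $P_r \<subseteq> V x$.
\<close>

lemma quotient_in_P: "y \<in> P \<Longrightarrow> x \<notin> P \<Longrightarrow> y \<cdot> x\<^sup>- \<in> P"
  using mult_P total_P by blast

text \<open>
  A component that is not a $W$-module is sandwiched: a missing multiple $w x$ of an element $x$ of $P_r$
  bounds $P_r$ from above; and if $y$ is missing in the same degree, then $x \<in> V y$, so $w x \<in> W y$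
  and $y$ is not in $J(W) w x$.
\<close>

lemma W_stable:
  assumes "deg x \<notin> sandwich_degrees" "x \<in> P" "w \<in> W" shows "w \<cdot> x \<in> P"
proof (rule ccontr)
  assume n: "w \<cdot> x \<notin> P"
  have "sandwiched (w \<cdot> x)" unfolding sandwiched_iff
  proof (intro conjI allI ballI impI)
    fix y assume "y \<in> P" "deg y = deg (w \<cdot> x)"
    then show "y \<cdot> (w \<cdot> x)\<^sup>- \<in> W"
      using quotient_in_P[OF _ n] P_degree_0 by simp
  next
    fix y assume y: "deg y = deg (w \<cdot> x)" "w \<cdot> x \<cdot> y\<^sup>- \<notin> W"
    show "y \<in> P"
    proof (rule ccontr)
      assume "y \<notin> P"
      then have "x \<cdot> y\<^sup>- \<in> W" using quotient_in_P[OF assms(2)] P_degree_0 y assms by (simp add: deg_W)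
      then show False using y mult_W[of w "x \<cdot> y\<^sup>-"] assms by simp
    qed
  qed
  then have "deg (w \<cdot> x) \<in> sandwich_degrees" unfolding sandwich_degrees_def by blast
  then show False using assms by (simp add: deg_W)
qed

text \<open>
  Otherwise $x$ itself would be sandwiched, because then $P_r = W x$.
\<close>

lemma not_principal:
  assumes "deg x \<notin> sandwich_degrees" "x \<in> P"
  shows "\<exists>y\<in>P. deg y = deg x \<and> y \<cdot> x\<^sup>- \<notin> W"
proof (rule ccontr)
  assume "\<not> ?thesis"
  then have up: "y \<cdot> x\<^sup>- \<in> W" if "y \<in> P" "deg y = deg x" for y using that by blast
  have "sandwiched x" unfolding sandwiched_iff
  proof (intro conjI allI ballI impI)
    fix y assume y: "deg y = deg x" "x \<cdot> y\<^sup>- \<notin> W"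
    then have "y \<cdot> x\<^sup>- \<in> W" using total_W[of "x \<cdot> y\<^sup>-"] by simp
    then show "y \<in> P" using W_stable[OF assms, of "y \<cdot> x\<^sup>-"] by simp
  qed (use up in auto)
  then show False using assms unfolding sandwich_degrees_def by blast
qed

text \<open>
  Off the sandwiched degrees, a missing element $x$ can be separated from $P_r$ by a principal module:
  $P_r \<subseteq> W y$ and $x \<notin> W y$. If no such $y$ existed, then $J(W) x \<subseteq> P_r \<subseteq> W x$.
\<close>

lemma intersection_of_principal:
  assumes "deg x \<notin> sandwich_degrees" "x \<notin> P"
  shows "\<exists>y. y \<notin> P \<and> deg y = deg x \<and> x \<cdot> y\<^sup>- \<notin> W"
proof (rule ccontr)
  assume "\<not> ?thesis"
  then have *: "y \<in> P" if "x \<cdot> y\<^sup>- \<notin> W" "deg y = deg x" for y using that by blast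
  have "sandwiched x" unfolding sandwiched_iff
    using * quotient_in_P[OF _ assms(2)] P_degree_0 by auto
  then show False using assms unfolding sandwich_degrees_def by blast
qed

text \<open>
  $J(W) g P_{-r}$ is a left $W$-module inside $V$, hence contains no unit of $W$; cancelling $J(W)$
  leaves $g P_{-r} \<subseteq> W$.
\<close>

lemma inverse_upper:
  assumes g: "sandwiched g" and x: "x \<in> P" "deg x = - deg g"
  shows "g \<cdot> x \<in> W"
proof (rule ccontr)
  assume n: "g \<cdot> x \<notin> W"
  have "W \<subseteq> P"
  proof
    fix w assume w: "w \<in> W"
    have "x\<^sup>- \<cdot> g\<^sup>- \<in> rad" using n x by (simp add: rad_def)
    then have "w \<cdot> (x\<^sup>- \<cdot> g\<^sup>-) \<in> rad" by (rule W_mult_rad[OF w])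
    from sandwiched_rad[OF g this] mult_P[OF _ x(1)] show "w \<in> P" by fastforce
  qed
  then show False using not_W_subset_P by simp
qed

lemma inverse_lower:
  assumes g: "sandwiched g" and x: "deg x = - deg g" "x\<^sup>- \<cdot> g\<^sup>- \<notin> W"
  shows "x \<in> P"
  using total_P[of x] sandwiched_upper[OF g, of "x\<^sup>-"] x by auto

lemma inverse_rad: "sandwiched g \<Longrightarrow> j \<in> rad \<Longrightarrow> g\<^sup>- \<cdot> j \<in> P"
  using inverse_lower[of g "g\<^sup>- \<cdot> j"] by (simp add: rad_def)

lemma sandwiched_cong:
  assumes g: "sandwiched g" and "x \<approx> g" "deg x = deg g" shows "sandwiched x"
  unfolding sandwiched_iff
proof (intro conjI allI ballI impI)
  fix y assume "deg y = deg x" "x \<cdot> y\<^sup>- \<notin> W"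
  then show "y \<in> P" using sandwiched_lower[OF g, of y] mult_W[of "x \<cdot> g\<^sup>-" "g \<cdot> y\<^sup>-"] assms
    by (auto simp: assoc_eq_def)
next
  fix y assume "y \<in> P" "deg y = deg x"
  then show "y \<cdot> x\<^sup>- \<in> W" using sandwiched_upper[OF g, of y] mult_W[of "y \<cdot> g\<^sup>-" "g \<cdot> x\<^sup>-"] assms
    by (auto simp: assoc_eq_def)
qed

lemma sandwiched_unique:
  assumes g: "sandwiched g" and h: "sandwiched h" "deg g = deg h" shows "g \<approx> h"
proof -
  have *: "g \<cdot> h\<^sup>- \<in> W" if g: "sandwiched g" and h: "sandwiched h" "deg g = deg h" for g h
  proof (rule rad_test)
    fix k assume "k \<in> rad"
    then show "k \<cdot> (g \<cdot> h\<^sup>-) \<in> W"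
      using sandwiched_upper[OF h(1) sandwiched_rad[OF g]] h by (simp add: rad_deg)
  qed (use h in simp)
  show ?thesis using *[OF assms] *[OF h(1) g] h(2) by (simp add: assoc_eq_def)
qed

lemma sandwiched_one: "sandwiched \<one>"
proof -
  have "x \<in> P" if "deg x = 0" "x\<^sup>- \<notin> W" for x
    using that total_P[of x] P_degree_0[of "x\<^sup>-"] by auto
  then show ?thesis using P_degree_0 by (auto simp: sandwiched_iff)
qed

end

section \<open>Cones whose stabilisers lie in W\<close>

text \<open>
  $W$ is the largest left stabiliser of a component, and it is attained.
\<close>

locale bounded_cone = cone +
  assumes stabilizer_W: "deg u = 0 \<Longrightarrow> (\<And>x. x \<in> P \<Longrightarrow> deg x = r \<Longrightarrow> u \<cdot> x \<in> P) \<Longrightarrow> u \<in> W"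
    and stabilizer_attained: "\<exists>t. \<forall>w\<in>W. \<forall>x\<in>P. deg x = t \<longrightarrow> w \<cdot> x \<in> P"
begin

text \<open>
  The right stabiliser of $P_r$ is the left stabiliser of $P_{-r}$. The only obstruction, an element
  $z^{-1}$ of $P_r$ inverse to $z$ in $P_{-r}$, disappears because $z^{-1} u$ is then in $P_r$ as well.
\<close>

lemma right_stabilizer_W:
  assumes u: "deg u = 0" and *: "\<And>x. x \<in> P \<Longrightarrow> deg x = r \<Longrightarrow> x \<cdot> u \<in> P"
  shows "u \<in> W"
proof (rule stabilizer_W[where r = "-r"])
  fix z assume z: "z \<in> P" "deg z = - r"
  show "u \<cdot> z \<in> P"
  proof (rule ccontr)
    assume "u \<cdot> z \<notin> P"
    then have "z\<^sup>- \<cdot> u\<^sup>- \<in> P" using total_P[of "u \<cdot> z"] by simp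
    then have "z\<^sup>- \<cdot> u\<^sup>- \<cdot> u \<in> P" using z u by (intro *) simp_all
    then have "z\<^sup>- \<cdot> u \<in> P" using z u by (intro *) simp_all
    then have "z \<cdot> (z\<^sup>- \<cdot> u) \<cdot> z \<in> P" using z mult_P by blast
    then show False using \<open>u \<cdot> z \<notin> P\<close> by simp
  qed
qed fact

text \<open>
  Here $P_r = W g$, and $g^{-1} W g$ is its right stabiliser, hence inside $W$. If $g W g^{-1}$ were larger than
  $W$, then $P_{2r} = W g W g$ would be a left module over it, although left stabilisers lie in $W$.
\<close>

lemma conj_W_if_principal:
  assumes g: "sandwiched g" and full: "\<And>w. w \<in> W \<Longrightarrow> w \<cdot> g \<in> P" and u: "u \<in> W"
  shows "g\<^sup>- \<cdot> u \<cdot> g \<in> W" "g \<cdot> u \<cdot> g\<^sup>- \<in> W"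
proof -
  show "g\<^sup>- \<cdot> u \<cdot> g \<in> W"
  proof (rule right_stabilizer_W[where r = "deg g"])
    fix x assume x: "x \<in> P" "deg x = deg g"
    have "(x \<cdot> g\<^sup>-) \<cdot> u \<in> W" using sandwiched_upper[OF g x] u mult_W by blast
    from full[OF this] show "x \<cdot> (g\<^sup>- \<cdot> u \<cdot> g) \<in> P" by simp
  qed (use u in \<open>simp add: deg_W\<close>)
next
  show "g \<cdot> u \<cdot> g\<^sup>- \<in> W"
  proof (rule ccontr)
    assume n: "g \<cdot> u \<cdot> g\<^sup>- \<notin> W"
    have "g \<cdot> u \<cdot> g\<^sup>- \<in> W"
    proof (rule stabilizer_W[where r = "deg g + deg g"])
      fix y assume y: "y \<in> P" "deg y = deg g + deg g"
      let ?b = "g\<^sup>- \<cdot> y \<cdot> g\<^sup>-"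
      have "g \<cdot> u\<^sup>- \<cdot> g\<^sup>- \<in> rad" using n u by (simp add: rad_def deg_W)
      then have "g\<^sup>- \<cdot> (g \<cdot> u\<^sup>- \<cdot> g\<^sup>-) \<cdot> y \<in> P" using inverse_rad[OF g] y mult_P by blast
      then have "u\<^sup>- \<cdot> g\<^sup>- \<cdot> y \<cdot> g\<^sup>- \<in> W" using sandwiched_upper[OF g, of "u\<^sup>- \<cdot> g\<^sup>- \<cdot> y"] y u by (simp add: deg_W)
      from mult_W[OF u mult_W[OF u this]] have "u \<cdot> ?b \<in> W" by simp
      from mult_P[OF _ full[OF this], of g] have "g \<cdot> ((u \<cdot> ?b) \<cdot> g) \<in> P"
        using full[OF one_W] by simp
      then show "g \<cdot> u \<cdot> g\<^sup>- \<cdot> y \<in> P" by simp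
    qed (use u in \<open>simp add: deg_W\<close>)
    with n show False ..
  qed
qed

text \<open>
  The same argument with $P_r = J(W) g$: now $P_{2r} = g J(W) g$, and idempotence of the radical is
  needed to recognise the elements of this product.
\<close>

lemma conj_W_if_rad:
  assumes g: "sandwiched g" and rad: "\<And>x. x \<in> P \<Longrightarrow> deg x = deg g \<Longrightarrow> g \<cdot> x\<^sup>- \<notin> W" and u: "u \<in> W"
  shows "g\<^sup>- \<cdot> u \<cdot> g \<in> W" "g \<cdot> u \<cdot> g\<^sup>- \<in> W"
proof -
  have rad': "x \<cdot> g\<^sup>- \<in> rad" if "x \<in> P" "deg x = deg g" for x
    using rad[OF that] that by (simp add: rad_def)
  have A: "g\<^sup>- \<cdot> w \<cdot> g \<in> W" if w: "w \<in> W" for w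
  proof (rule right_stabilizer_W[where r = "deg g"])
    fix x assume x: "x \<in> P" "deg x = deg g"
    from sandwiched_rad[OF g rad_mult_W[OF rad'[OF x] w]]
    show "x \<cdot> (g\<^sup>- \<cdot> w \<cdot> g) \<in> P" by simp
  qed (use w in \<open>simp add: deg_W\<close>)
  from A[OF u] show "g\<^sup>- \<cdot> u \<cdot> g \<in> W" .
  have conj_rad: "g \<cdot> j \<cdot> g\<^sup>- \<in> rad" if "j \<in> rad" for j
    using A[of "g \<cdot> j\<^sup>- \<cdot> g\<^sup>-"] that by (auto simp: rad_def)
  have inv: "g\<^sup>- \<in> P"
    using rad[of g] total_P[of g] by auto
  show "g \<cdot> u \<cdot> g\<^sup>- \<in> W"
  proof (rule stabilizer_W[where r = "deg g + deg g"])
    fix y assume y: "y \<in> P" "deg y = deg g + deg g"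
    let ?b = "g\<^sup>- \<cdot> y \<cdot> g\<^sup>-"
    have "g\<^sup>- \<cdot> y \<in> P" using inv y mult_P by blast
    from W_mult_rad[OF u rad'[OF this]] have "u \<cdot> ?b \<in> rad" using y by simp
    then obtain j k where jk: "j \<in> rad" "k \<in> rad" "u \<cdot> ?b = j \<cdot> k" by (rule rad_factor)
    have "(g \<cdot> j \<cdot> g\<^sup>- \<cdot> g) \<cdot> (k \<cdot> g) \<in> P"
      using sandwiched_rad[OF g conj_rad[OF jk(1)]] sandwiched_rad[OF g jk(2)] mult_P by blast
    also have "(g \<cdot> j \<cdot> g\<^sup>- \<cdot> g) \<cdot> (k \<cdot> g) = g \<cdot> (j \<cdot> k) \<cdot> g" by simp
    finally show "g \<cdot> u \<cdot> g\<^sup>- \<cdot> y \<in> P" by (simp flip: jk(3))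
  qed (use u in \<open>simp add: deg_W\<close>)
qed

text \<open>
  If $g$ and $g^{-1} w$ both lie in the cone for a unit $w$ of $W$, then multiplication by $g$ maps $P_{t-r}$ onto
  $P_t$ and $P_t$ onto $P_{t+r}$, where $r$ is the degree of $g$ and $t$ a degree with stabiliser $W$.
  So $g^{-1} W g$ and $g W g^{-1}$ are stabilisers too.
\<close>

lemma conj_W_if_proper:
  assumes g: "g \<in> P" and w: "w \<in> W" "w\<^sup>- \<in> W" "g\<^sup>- \<cdot> w \<in> P" and u: "u \<in> W"
  shows "g\<^sup>- \<cdot> u \<cdot> g \<in> W" "g \<cdot> u \<cdot> g\<^sup>- \<in> W"
proof -
  obtain t where t: "\<And>w x. w \<in> W \<Longrightarrow> x \<in> P \<Longrightarrow> deg x = t \<Longrightarrow> w \<cdot> x \<in> P"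
    using stabilizer_attained by blast
  have A: "g\<^sup>- \<cdot> u \<cdot> g \<in> W" if u: "u \<in> W" for u
  proof (rule stabilizer_W[where r = "t - deg g"])
    fix x assume x: "x \<in> P" "deg x = t - deg g"
    have "(w\<^sup>- \<cdot> u) \<cdot> (g \<cdot> x) \<in> P" using x g u w by (intro t mult_P mult_W) auto
    then have "(g\<^sup>- \<cdot> w) \<cdot> ((w\<^sup>- \<cdot> u) \<cdot> (g \<cdot> x)) \<in> P" using w mult_P by blast
    then show "g\<^sup>- \<cdot> u \<cdot> g \<cdot> x \<in> P" by simp
  qed (use u in \<open>simp add: deg_W\<close>)
  then show "g\<^sup>- \<cdot> u \<cdot> g \<in> W" using u .
  show "g \<cdot> u \<cdot> g\<^sup>- \<in> W"
  proof (rule stabilizer_W[where r = "t + deg g"])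
    fix x assume x: "x \<in> P" "deg x = t + deg g"
    have d: "deg w = 0" using deg_W w by simp
    have "u \<cdot> (g\<^sup>- \<cdot> w\<^sup>- \<cdot> g) \<in> W" using A[OF w(2)] u mult_W by blast
    moreover have "(g\<^sup>- \<cdot> w) \<cdot> x \<in> P" using w x mult_P by blast
    ultimately have "(u \<cdot> (g\<^sup>- \<cdot> w\<^sup>- \<cdot> g)) \<cdot> ((g\<^sup>- \<cdot> w) \<cdot> x) \<in> P"
      using x d t[of "u \<cdot> (g\<^sup>- \<cdot> w\<^sup>- \<cdot> g)" "(g\<^sup>- \<cdot> w) \<cdot> x"] by simp
    from mult_P[OF g this] show "g \<cdot> u \<cdot> g\<^sup>- \<cdot> x \<in> P" by simp
  qed (use u in \<open>simp add: deg_W\<close>)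
qed

text \<open>
  A sandwiched element normalises $W$. Either the component is one of the extremes $W g$ and $J(W) g$,
  or it contains some generator $a$ of $W g$ but not all of $W g$; in the latter case
  totality supplies $g^{-1} w^{-1}$ in $P_{-r}$, and \<open>conj_W_if_proper\<close> applies to $a$.
\<close>

lemma conj_W:
  assumes g: "sandwiched g" and u: "u \<in> W"
  shows "g\<^sup>- \<cdot> u \<cdot> g \<in> W" "g \<cdot> u \<cdot> g\<^sup>- \<in> W"
proof -
  have "g\<^sup>- \<cdot> u \<cdot> g \<in> W \<and> g \<cdot> u \<cdot> g\<^sup>- \<in> W"
  proof (cases "(\<forall>w\<in>W. w \<cdot> g \<in> P) \<or> (\<forall>x\<in>P. deg x = deg g \<longrightarrow> g \<cdot> x\<^sup>- \<notin> W)")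
    case True
    then show ?thesis using conj_W_if_principal[OF g _ u] conj_W_if_rad[OF g _ u] by blast
  next
    case False
    then obtain w a where w: "w \<in> W" "w \<cdot> g \<notin> P" and a: "a \<in> P" "deg a = deg g" "g \<cdot> a\<^sup>- \<in> W" by blast
    have ag: "a \<cdot> g\<^sup>- \<in> W" using sandwiched_upper[OF g] a by blast
    have p: "g\<^sup>- \<cdot> w\<^sup>- \<in> P" using total_P[of "w \<cdot> g"] w by simp
    have w': "w\<^sup>- \<in> W" using inverse_upper[OF g p] w by (simp add: deg_W)
    have conj: "a\<^sup>- \<cdot> v \<cdot> a \<in> W" "a \<cdot> v \<cdot> a\<^sup>- \<in> W" if "v \<in> W" for v
      using conj_W_if_proper[OF a(1), of "a \<cdot> g\<^sup>- \<cdot> w\<^sup>-" v] that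
        mult_W[OF ag w'] mult_W[OF w(1) a(3)] p by simp_all
    have 1: "g\<^sup>- \<cdot> u \<cdot> g \<in> W"
      using conj(1)[OF mult_W[OF ag mult_W[OF u a(3)]]] by simp
    have 2: "g \<cdot> u \<cdot> g\<^sup>- \<in> W"
      using mult_W[OF a(3) mult_W[OF conj(2)[OF u] ag]] by simp
    from 1 2 show ?thesis ..
  qed
  then show "g\<^sup>- \<cdot> u \<cdot> g \<in> W" "g \<cdot> u \<cdot> g\<^sup>- \<in> W" by blast+
qed

lemma sandwiched_normalizes: "sandwiched g \<Longrightarrow> normalizes_W g"
  using conj_W by (simp add: normalizes_W_def del: assoc)

lemma conj_rad:
  assumes "sandwiched g" "j \<in> rad"
  shows "g\<^sup>- \<cdot> j \<cdot> g \<in> rad" "g \<cdot> j \<cdot> g\<^sup>- \<in> rad"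
  using normalizes_rad[OF sandwiched_normalizes] assms by blast+

lemma sandwiched_inv:
  assumes g: "sandwiched g" shows "sandwiched (g\<^sup>-)"
  unfolding sandwiched_iff
proof (intro conjI allI ballI impI)
  fix x assume x: "deg x = deg (g\<^sup>-)" "g\<^sup>- \<cdot> x\<^sup>- \<notin> W"
  then have "x\<^sup>- \<cdot> g\<^sup>- \<notin> W" using conj_W(1)[OF g, of "x\<^sup>- \<cdot> g\<^sup>-"] by auto
  then show "x \<in> P" using inverse_lower[OF g, of x] x by auto
next
  fix x assume x: "x \<in> P" "deg x = deg (g\<^sup>-)"
  then show "x \<cdot> (g\<^sup>-)\<^sup>- \<in> W" using conj_W(1)[OF g, of "g \<cdot> x"] inverse_upper[OF g, of x] by auto
qed

lemma rad_product:
  assumes "sandwiched g" "sandwiched h" "j \<in> rad"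
  obtains x y where "x \<in> P" "y \<in> P" "deg x = deg g" "deg y = deg h" "x \<cdot> y = j \<cdot> g \<cdot> h"
proof -
  obtain k l where kl: "k \<in> rad" "l \<in> rad" "j = k \<cdot> l" using rad_factor assms by blast
  show ?thesis
  proof (rule that[of "k \<cdot> g" "(g\<^sup>- \<cdot> l \<cdot> g) \<cdot> h"])
    show "(g\<^sup>- \<cdot> l \<cdot> g) \<cdot> h \<in> P"
      by (rule sandwiched_rad[OF assms(2) conj_rad(1)[OF assms(1) kl(2)]])
  qed (use kl assms in \<open>auto simp: rad_deg intro: sandwiched_rad\<close>)
qed

text \<open>
  The lower bound uses $J(W) g h = J(W) g J(W) h$, the upper bound
  $g^{-1} J(W) P_{r+s} \<subseteq> P_s \<subseteq> W h$.
\<close>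

lemma sandwiched_mult:
  assumes g: "sandwiched g" and h: "sandwiched h" shows "sandwiched (g \<cdot> h)"
  unfolding sandwiched_iff
proof (intro conjI allI ballI impI)
  fix x assume x: "deg x = deg (g \<cdot> h)" "g \<cdot> h \<cdot> x\<^sup>- \<notin> W"
  then have "x \<cdot> h\<^sup>- \<cdot> g\<^sup>- \<in> rad" by (simp add: rad_def)
  then obtain a b where "a \<in> P" "b \<in> P" "a \<cdot> b = x \<cdot> h\<^sup>- \<cdot> g\<^sup>- \<cdot> g \<cdot> h" using rad_product[OF g h] by metis
  then show "x \<in> P" using mult_P[of a b] by simp
next
  fix x assume x: "x \<in> P" "deg x = deg (g \<cdot> h)"
  show "x \<cdot> (g \<cdot> h)\<^sup>- \<in> W"
  proof (rule rad_test)
    fix k assume k: "k \<in> rad"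
    have "g\<^sup>- \<cdot> k \<cdot> x \<in> P" using inverse_rad[OF g k] x mult_P by blast
    from sandwiched_upper[OF h this] have "g\<^sup>- \<cdot> k \<cdot> x \<cdot> h\<^sup>- \<in> W" using x k by (simp add: rad_deg)
    from conj_W(2)[OF g this] show "k \<cdot> (x \<cdot> (g \<cdot> h)\<^sup>-) \<in> W" by simp
  qed (use x in simp)
qed

lemma sandwich_degrees_subgroup: "add_subgroup sandwich_degrees"
  unfolding add_subgroup_def sandwich_degrees_def
proof (intro conjI ballI)
  show "0 \<in> deg ` {g. sandwiched g}" using sandwiched_one deg_one by force
next
  fix r s assume "r \<in> deg ` {g. sandwiched g}" "s \<in> deg ` {g. sandwiched g}"
  then obtain g h where "sandwiched g" "sandwiched h" "r = deg g" "s = deg h" by blast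
  then show "r - s \<in> deg ` {g. sandwiched g}"
    using sandwiched_mult[of g "h\<^sup>-"] sandwiched_inv[of h] by (intro image_eqI[of _ _ "g \<cdot> h\<^sup>-"]) auto
qed


text \<open>
  If $x w \<notin> P$, then $w^{-1} x^{-1}$ and, by left stability in degree $-r$, also $x^{-1}$ are in the cone; then
  $P_r x^{-1} \<subseteq> V$ makes $P_r$ principal.
\<close>

lemma W_right_stable:
  assumes x: "deg x \<notin> sandwich_degrees" "x \<in> P" and w: "w \<in> W" shows "x \<cdot> w \<in> P"
proof (rule ccontr)
  assume "x \<cdot> w \<notin> P"
  then have 1: "w\<^sup>- \<cdot> x\<^sup>- \<in> P" using total_P[of "x \<cdot> w"] by simp
  have "- deg x \<notin> sandwich_degrees"
    using x(1) sandwich_degrees_subgroup unfolding add_subgroup_def by (metis diff_0 minus_minus)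
  then have "w \<cdot> (w\<^sup>- \<cdot> x\<^sup>-) \<in> P" using w by (intro W_stable[OF _ 1]) (simp_all add: deg_W)
  then have inv: "x\<^sup>- \<in> P" by simp
  obtain x' where "x' \<in> P" "deg x' = deg x" "x' \<cdot> x\<^sup>- \<notin> W" using not_principal[OF x] by blast
  then show False using P_degree_0[OF mult_P[OF _ inv]] by simp
qed

text \<open>
  Suppose that $z$ is not a product. Then $x^{-1} z \<notin> P_b$, that is $z^{-1} x \<in> P_{-b}$, for all
  $x \<in> P_a$. So $z' z^{-1}$ stabilises $P_a$ for every $z' \<in> P_{a+b}$, hence lies in $W$, and
  $P_{a+b} \<subseteq> W z$ is principal. This excludes \<open>H = {0}\<close> in Type (II).
\<close>

lemma product_decomposition:
  assumes z: "z \<in> P" "deg z = a + b" "a + b \<notin> sandwich_degrees"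
  shows "\<exists>x\<in>P. \<exists>y\<in>P. deg x = a \<and> deg y = b \<and> z = x \<cdot> y"
proof (rule ccontr)
  assume n: "\<not> ?thesis"
  obtain z' where z': "z' \<in> P" "deg z' = deg z" "z' \<cdot> z\<^sup>- \<notin> W" using not_principal[of z] z by auto
  have "z' \<cdot> z\<^sup>- \<in> W"
  proof (rule stabilizer_W[where r = a])
    fix x assume x: "x \<in> P" "deg x = a"
    have "x\<^sup>- \<cdot> z \<notin> P"
    proof
      assume "x\<^sup>- \<cdot> z \<in> P"
      moreover have "deg (x\<^sup>- \<cdot> z) = b" "z = x \<cdot> (x\<^sup>- \<cdot> z)" using x z by simp_all
      ultimately show False using n x by blast
    qed
    then have "z\<^sup>- \<cdot> x \<in> P" using total_P[of "x\<^sup>- \<cdot> z"] by simp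
    from mult_P[OF z'(1) this] show "z' \<cdot> z\<^sup>- \<cdot> x \<in> P" by simp
  qed (use z' in simp)
  with z' show False by simp
qed

lemma sandwiched_multiple:
  assumes "sandwiched g"
  obtains y where "sandwiched y" "deg y = of_nat n * deg g" "g \<in> P \<Longrightarrow> y \<in> P" "g\<^sup>- \<in> P \<Longrightarrow> y\<^sup>- \<in> P"
proof -
  have one: "\<one> \<in> P" using total_P[of \<one>] by simp
  have "\<exists>y. sandwiched y \<and> deg y = of_nat n * deg g \<and> (g \<in> P \<longrightarrow> y \<in> P) \<and> (g\<^sup>- \<in> P \<longrightarrow> y\<^sup>- \<in> P)"
  proof (induction n)
    case 0
    then show ?case using one sandwiched_one by (intro exI[of _ \<one>]) simp
  next
    case (Suc n)
    then obtain y where "sandwiched y" "deg y = of_nat n * deg g" "g \<in> P \<longrightarrow> y \<in> P" "g\<^sup>- \<in> P \<longrightarrow> y\<^sup>- \<in> P"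
      by blast
    then show ?case using sandwiched_mult[OF assms] mult_P
      by (intro exI[of _ "g \<cdot> y"]) (auto simp: algebra_simps)
  qed
  then show ?thesis using that by blast
qed

text \<open>
  The component with stabiliser $W$ is $W g$ or $J(W) g$; in the second case the opposite
  component is $W g^{-1}$.
\<close>

lemma full_component:
  assumes all: "sandwich_degrees = UNIV"
  obtains g where "sandwiched g" "deg g \<noteq> 0" "\<And>w. w \<in> W \<Longrightarrow> w \<cdot> g \<in> P"
proof -
  obtain t where t: "\<And>w x. w \<in> W \<Longrightarrow> x \<in> P \<Longrightarrow> deg x = t \<Longrightarrow> w \<cdot> x \<in> P"
    using stabilizer_attained by blast
  have t0: "t \<noteq> 0"
    using t[of _ \<one>] total_P[of \<one>] not_W_subset_P by auto
  obtain g where g: "sandwiched g" "deg g = t" using all unfolding sandwich_degrees_def by (metis UNIV_I imageE mem_Collect_eq)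
  show ?thesis
  proof (cases "\<exists>x\<in>P. deg x = deg g \<and> g \<cdot> x\<^sup>- \<in> W")
    case True
    then obtain x where x: "x \<in> P" "deg x = t" "g \<cdot> x\<^sup>- \<in> W" using g by blast
    have "w \<cdot> g \<in> P" if "w \<in> W" for w using t[OF mult_W[OF that x(3)] x(1,2)] by simp
    then show ?thesis using that g t0 by blast
  next
    case False
    have "w \<cdot> g\<^sup>- \<in> P" if w: "w \<in> W" for w
    proof (rule ccontr)
      assume "w \<cdot> g\<^sup>- \<notin> P"
      then have "g \<cdot> w\<^sup>- \<in> P" using total_P[of "w \<cdot> g\<^sup>-"] by simp
      then have "g \<cdot> (g \<cdot> w\<^sup>-)\<^sup>- \<notin> W" using False w deg_W by auto
      then show False using conj_W(2)[OF g(1) w] by simp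
    qed
    then show ?thesis using that[of "g\<^sup>-"] sandwiched_inv g t0 by auto
  qed
qed

text \<open>
  One full component $W g$ in degree $T \<noteq> 0$ forces $P_s = W h$ in every degree $s$ on the side of $T$: a
  missing generator $x$ of $W h$ has $x^{-1} \<in> P$, and a common multiple $q s = p T$ gives
  $W = W x^q x^{-q} \<subseteq> P$. On the other side all components are $J(W) h$. Hence components of equal sign
  multiply as in Type (I), which excludes $H = Q$ in Type (II).
\<close>

lemma product_decomposition_if_all_sandwiched:
  assumes all: "sandwich_degrees = UNIV" and ab: "a * b > 0" and z: "z \<in> P" "deg z = a + b"
  shows "\<exists>x\<in>P. \<exists>y\<in>P. deg x = a \<and> deg y = b \<and> z = x \<cdot> y"
proof -
  obtain g where g: "sandwiched g" "deg g \<noteq> 0" "\<And>w. w \<in> W \<Longrightarrow> w \<cdot> g \<in> P" using full_component[OF all] by blast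
  have full: "w \<cdot> h \<in> P" if h: "sandwiched h" "deg h * deg g > 0" and w: "w \<in> W" for h w
  proof (rule ccontr)
    assume n: "w \<cdot> h \<notin> P"
    let ?x = "w \<cdot> h"
    have dx: "deg ?x = deg h" using w by (simp add: deg_W)
    have inv: "?x\<^sup>- \<in> P" using total_P[of ?x] n by simp
    have "h \<cdot> ?x\<^sup>- \<in> W" using sandwiched_lower[OF h(1) dx] n by blast
    then have x: "sandwiched ?x" using sandwiched_cong[OF h(1), of ?x] w dx by (simp add: assoc_eq_def)
    obtain p q :: int where pq: "deg h / deg g = of_int p / of_int q" "q > 0"
      by (metis quotient_of_div quotient_of_denom_pos surj_pair)
    have "deg h / deg g > 0" using h(2) by (auto simp: zero_less_divide_iff zero_less_mult_iff)
    then have p: "p > 0" using pq by (auto simp: zero_less_divide_iff)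
    have "of_int q * deg h = of_int p * deg g" using pq g by (simp add: field_simps)
    then have e: "of_nat (nat q) * deg h = of_nat (nat p) * deg g" using p pq by simp
    obtain y where y: "sandwiched y" "deg y = of_nat (nat q) * deg h" "y\<^sup>- \<in> P"
      using sandwiched_multiple[OF x, of "nat q"] inv dx by metis
    have gP: "g \<in> P" using g(3)[OF one_W] by simp
    obtain m where m: "nat p = Suc m" using p by (metis gr0_conv_Suc zero_less_nat_eq)
    obtain k where k: "sandwiched k" "deg k = of_nat m * deg g" "k \<in> P"
      using sandwiched_multiple[OF g(1), of m] gP by metis
    have "y \<approx> g \<cdot> k"
      using sandwiched_unique[OF y(1) sandwiched_mult[OF g(1) k(1)]] y k e m by (simp add: algebra_simps)
    then have yk: "y \<cdot> k\<^sup>- \<cdot> g\<^sup>- \<in> W" by (simp add: assoc_eq_def)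
    have "W \<subseteq> P"
    proof
      fix v assume "v \<in> W"
      from g(3)[OF mult_W[OF this yk]] have "v \<cdot> y \<cdot> k\<^sup>- \<in> P" by simp
      from mult_P[OF mult_P[OF this k(3)] y(3)] show "v \<in> P" by simp
    qed
    then show False using not_W_subset_P by simp
  qed
  have "\<exists>h. sandwiched h \<and> deg h = r" for r using all unfolding sandwich_degrees_def by (metis UNIV_I imageE mem_Collect_eq)
  then obtain h k where h: "sandwiched h" "deg h = a" and k: "sandwiched k" "deg k = b" by metis
  have hk: "sandwiched (h \<cdot> k)" by (rule sandwiched_mult[OF h(1) k(1)])
  have zW: "z \<cdot> (h \<cdot> k)\<^sup>- \<in> W" using sandwiched_upper[OF hk z(1)] z h k by simp
  consider "a * deg g > 0" "b * deg g > 0" | "a * deg g < 0" "b * deg g < 0"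
    using ab g(2) by (cases "deg g > 0"; cases "a > 0") (auto simp: zero_less_mult_iff mult_less_0_iff)
  then show ?thesis
  proof cases
    case 1
    show ?thesis
      using full[OF h(1) _ zW] full[OF k(1) _ one_W] 1 z h k
      by (intro bexI[of _ "z \<cdot> k\<^sup>-"] bexI[of _ k]) simp_all
  next
    case 2
    have "z \<cdot> (h \<cdot> k)\<^sup>- \<in> rad"
    proof (rule ccontr)
      assume "z \<cdot> (h \<cdot> k)\<^sup>- \<notin> rad"
      then have zi: "h \<cdot> k \<cdot> z\<^sup>- \<in> W" using z h k by (simp add: rad_def)
      have "W \<subseteq> P"
      proof
        fix w assume w: "w \<in> W"
        have s: "(a + b) * deg g < 0" using 2 by (simp add: algebra_simps)
        have "w \<cdot> ((h \<cdot> k)\<^sup>- \<cdot> (h \<cdot> k \<cdot> z\<^sup>-) \<cdot> (h \<cdot> k)) \<in> W"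
          using conj_W(1)[OF hk zi] mult_W[OF w] by blast
        from full[OF sandwiched_inv[OF hk] _ this] have "w \<cdot> z\<^sup>- \<in> P" using s h k by (simp add: algebra_simps)
        from mult_P[OF this z(1)] show "w \<in> P" by simp
      qed
      then show False using not_W_subset_P by simp
    qed
    from rad_product[OF h(1) k(1) this] show ?thesis using z h k by (metis left_inverse assoc right_neutral inverse_distrib_swap)
  qed
qed


text \<open>
  On the sandwiched degrees the extremes $W g_r$ and $J(W) g_r$ multiply correctly because the $g_r$ normalise
  $W$; the other products are inherited.
\<close>

lemma companion_cone:
  assumes g: "\<And>s. s \<in> sandwich_degrees \<Longrightarrow> sandwiched (g s) \<and> deg (g s) = s"
  defines "M \<equiv> companion sandwich_degrees g P"
  shows "x \<in> M \<Longrightarrow> y \<in> M \<Longrightarrow> x \<cdot> y \<in> M" and "x \<in> M \<or> x\<^sup>- \<in> M"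
proof -
  let ?H = sandwich_degrees
  have H_diff: "r - s \<in> ?H" if "r \<in> ?H" "s \<in> ?H" for r s
    using sandwich_degrees_subgroup that by (simp add: add_subgroup_def)
  have H0: "0 \<in> ?H" using sandwich_degrees_subgroup by (simp add: add_subgroup_def)
  have H_minus: "- r \<in> ?H" if "r \<in> ?H" for r using H_diff[OF H0 that] by simp
  have H_add: "r + s \<in> ?H" if "r \<in> ?H" "s \<in> ?H" for r s using H_diff[OF that(1) H_minus[OF that(2)]] by simp
  have norm: "normalizes_W (g s)" if "s \<in> ?H" for s
    using sandwiched_normalizes g that by blast
  have sM: "sandwich M (g s)" if "s \<in> ?H" for s
    unfolding M_def using companion_sandwich g that by blast
  have M_rad: "x \<in> M" if "deg x \<in> ?H" "x \<cdot> (g (deg x))\<^sup>- \<in> rad" for x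
  proof -
    have "x \<cdot> (g (deg x))\<^sup>- \<cdot> g (deg x) \<in> M" using sM[OF that(1)] that(2) unfolding sandwich_def by blast
    then show ?thesis by simp
  qed
  have M_W: "x \<cdot> (g (deg x))\<^sup>- \<in> W" if "x \<in> M" "deg x \<in> ?H" for x
    using sM g that unfolding sandwich_def by metis
  have on_H: "x \<cdot> y \<in> M" if x: "x \<in> M" "deg x \<in> ?H" and y: "y \<in> M" "deg y \<in> ?H" for x y
  proof -
    let ?v = "x \<cdot> (g (deg x))\<^sup>-" and ?w = "y \<cdot> (g (deg y))\<^sup>-"
    let ?w' = "g (deg x) \<cdot> ?w \<cdot> (g (deg x))\<^sup>-"
    let ?e = "g (deg x) \<cdot> g (deg y) \<cdot> (g (deg x + deg y))\<^sup>-"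
    have "sandwiched (g (deg x) \<cdot> g (deg y))" using sandwiched_mult g x y by blast
    then have e: "?e \<in> W" using sandwiched_unique[of "g (deg x) \<cdot> g (deg y)" "g (deg x + deg y)"]
        g[OF x(2)] g[OF y(2)] g[OF H_add[OF x(2) y(2)]] by (simp add: assoc_eq_def)
    have v: "?v \<in> W" and w: "?w \<in> W" using M_W x y by auto
    have w': "?w' \<in> W" using conj_W(2)[OF _ w] g x by blast
    have eq: "x \<cdot> y \<cdot> (g (deg (x \<cdot> y)))\<^sup>- = ?v \<cdot> (?w' \<cdot> ?e)" by simp
    have W: "x \<cdot> y \<cdot> (g (deg (x \<cdot> y)))\<^sup>- \<in> W" unfolding eq using v w' e mult_W by blast
    consider "deg x > 0" | "deg y > 0" | "deg x = 0" "deg y = 0" | "deg x + deg y < 0" "deg x \<le> 0" "deg y \<le> 0" by linarith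
    then show ?thesis
    proof cases
      case 1
      then have "?v \<in> rad" using x by (simp add: M_def companion_def)
      then show ?thesis unfolding eq[symmetric]
        using M_rad[of "x \<cdot> y"] rad_mult_W[OF _ mult_W[OF w' e]] H_add x y unfolding eq by (metis deg_mult)
    next
      case 2
      then have "?w \<in> rad" using y by (simp add: M_def companion_def)
      then have "?w' \<in> rad" using conj_rad(2) g x by blast
      then show ?thesis
        using M_rad[of "x \<cdot> y"] W_mult_rad[OF v rad_mult_W[OF _ e]] H_add x y unfolding eq by (metis deg_mult)
    next
      case 3
      then show ?thesis using x y mult_P by (simp add: M_def companion_def)
    next
      case 4
      then show ?thesis using W H_add[OF x(2) y(2)] by (simp add: M_def companion_def)
    qed
  qed
  have total: "x \<in> M \<or> x\<^sup>- \<in> M" if x: "deg x \<in> ?H" for x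
  proof -
    have *: "x\<^sup>- \<in> M" if x: "deg x \<in> ?H" "deg x > 0" "x \<notin> M" for x
    proof -
      have xW: "g (deg x) \<cdot> x\<^sup>- \<in> W" using x g[OF x(1)] by (auto simp: M_def companion_def rad_def)
      have 1: "(g (deg x))\<^sup>- \<cdot> (g (deg x) \<cdot> x\<^sup>-) \<cdot> g (deg x) \<in> W" using conj_W(1)[OF _ xW] g x by blast
      have 2: "(g (deg x))\<^sup>- \<cdot> (g (- deg x))\<^sup>- \<in> W"
        using sandwiched_unique[of "(g (deg x))\<^sup>-" "g (- deg x)"] sandwiched_inv g[OF x(1)] g[OF H_minus[OF x(1)]]
        by (simp add: assoc_eq_def)
      from mult_W[OF 1 2] show ?thesis using x H_minus by (simp add: M_def companion_def)
    qed
    have **: "x \<in> M" if x: "deg x \<in> ?H" "deg x < 0" "x\<^sup>- \<notin> M" for x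
      using *[of "x\<^sup>-"] x H_minus by simp
    show ?thesis
    proof (cases "deg x = 0")
      case True
      then show ?thesis using total_P[of x] by (simp add: M_def companion_def)
    qed (use * ** x in \<open>meson linorder_neqE_linordered_idom\<close>)
  qed
  have off: "x \<in> M \<longleftrightarrow> x \<in> P" if "deg x \<notin> ?H" for x using that by (simp add: M_def companion_def)
  note transfer = cone_transfer[where H = ?H and P = P and g = g and Q = M, OF sandwich_degrees_subgroup
      mult_P total_P P_degree_0 _ off _ _ on_H total]
  show "x \<in> M \<Longrightarrow> y \<in> M \<Longrightarrow> x \<cdot> y \<in> M"
    by (rule transfer(1)) (use norm sM g W_stable W_right_stable not_principal in auto)
  show "x \<in> M \<or> x\<^sup>- \<in> M"
    by (rule transfer(2)) (use norm sM g W_stable W_right_stable not_principal in auto)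
qed

end

section \<open>Total valuation rings with idempotent radical\<close>

lemma group_closure_subset:
  assumes "S \<subseteq> T" "add_subgroup T" shows "group_closure S \<subseteq> T"
proof
  fix x assume "x \<in> group_closure S"
  then show "x \<in> T"
    by induction (use assms in \<open>auto simp: add_subgroup_def\<close>)
qed

lemma add_subgroup_minus: "add_subgroup S \<Longrightarrow> x \<in> S \<Longrightarrow> - x \<in> S"
  unfolding add_subgroup_def by (metis diff_0)

lemma add_subgroup_add: "add_subgroup S \<Longrightarrow> x \<in> S \<Longrightarrow> y \<in> S \<Longrightarrow> x + y \<in> S"
  using add_subgroup_minus[of S y] unfolding add_subgroup_def by (metis diff_minus_eq_add)

lemma add_subgroup_sum: "add_subgroup S \<Longrightarrow> (\<And>i. i \<in> I \<Longrightarrow> f i \<in> S) \<Longrightarrow> sum f I \<in> S"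
proof (induction I rule: infinite_finite_induct)
  case (insert i I)
  then show ?case by (simp add: add_subgroup_add)
qed (auto simp: add_subgroup_def)

lemma add_subgroup_rmul:
  assumes "add_subgroup S" shows "add_subgroup (rmul S c)"
  unfolding add_subgroup_def rmul_def
proof (safe, goal_cases)
  case 1 then show ?case using assms by (force simp: add_subgroup_def)
next
  case (2 x y a b) then show ?case using assms by (intro exI[of _ "a - b"]) (auto simp: add_subgroup_def left_diff_distrib)
qed

lemma add_subgroup_of_nat_mult:
  fixes H :: "rat set"
  assumes "add_subgroup H" "h \<in> H" shows "of_nat n * h \<in> H"
  using assms by (induction n) (auto simp: algebra_simps add_subgroup_add, simp add: add_subgroup_def)

lemma rat_common_unit:
  fixes a b :: rat
  obtains r i j where "r > 0" "a = of_int i * r" "b = of_int j * r"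
proof -
  obtain p q :: int where pq: "a = of_int p / of_int q" "q > 0"
    by (metis quotient_of_div quotient_of_denom_pos surj_pair)
  obtain p' q' :: int where pq': "b = of_int p' / of_int q'" "q' > 0"
    by (metis quotient_of_div quotient_of_denom_pos surj_pair)
  show ?thesis
    by (rule that[of "1 / (of_int q * of_int q')" "p * q'" "p' * q"]) (use pq pq' in \<open>auto simp: field_simps\<close>)
qed

lemma set_prod_mem: "a \<in> I \<Longrightarrow> b \<in> J \<Longrightarrow> a * b \<in> I \<odot> J"
  unfolding set_prod_def by (blast intro: group_closure.base)

lemma set_prod_subset: "add_subgroup T \<Longrightarrow> (\<And>a b. a \<in> I \<Longrightarrow> b \<in> J \<Longrightarrow> a * b \<in> T) \<Longrightarrow> I \<odot> J \<subseteq> T"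
  unfolding set_prod_def by (rule group_closure_subset) auto

lemma mem_rmul_iff: "c \<noteq> 0 \<Longrightarrow> x \<in> rmul S c \<longleftrightarrow> x * inverse c \<in> S" for c :: "'a::division_ring"
  unfolding rmul_def by (force simp: mult.assoc)

text \<open>
  The nonunits form a left ideal, since of two elements one is a left multiple of the other; it contains
  every proper left ideal.
\<close>

lemma jacobson_total_valuation_ring:
  assumes W: "total_valuation_ring W"
  shows "jacobson W = {x \<in> W. x = 0 \<or> inverse x \<notin> W}" (is "_ = ?N")
proof -
  have add: "add_subgroup W" and one: "1 \<in> W" and mult: "\<And>x y. x \<in> W \<Longrightarrow> y \<in> W \<Longrightarrow> x * y \<in> W"
    and total: "\<And>x. x \<noteq> 0 \<Longrightarrow> x \<in> W \<or> inverse x \<in> W"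
    using W by (auto simp: total_valuation_ring_def is_subring_def)
  have scale: "w * x \<in> ?N" if w: "w \<in> W" and x: "x \<in> ?N" for w x
  proof (cases "w * x = 0")
    case False
    then have "x \<noteq> 0" "w \<noteq> 0" by auto
    moreover have "inverse (w * x) \<notin> W"
    proof
      assume "inverse (w * x) \<in> W"
      then have "inverse (w * x) * w \<in> W" using mult w by blast
      then show False using x \<open>x \<noteq> 0\<close> \<open>w \<noteq> 0\<close> by (simp add: nonzero_inverse_mult_distrib mult.assoc)
    qed
    ultimately show ?thesis using w x mult by auto
  qed (use w x mult in auto)
  have diff: "x - y \<in> ?N" if x: "x \<in> ?N" and y: "y \<in> ?N" for x y
  proof (cases "x = 0 \<or> y = 0")
    case True
    then show ?thesis using scale[of "-1" y] x y one add_subgroup_minus[OF add one] by auto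
  next
    case False
    then consider "x * inverse y \<in> W" | "y * inverse x \<in> W"
      using total[of "x * inverse y"] by (auto simp: nonzero_inverse_mult_distrib)
    then show ?thesis
    proof cases
      case 1
      then have "(x * inverse y - 1) * y \<in> ?N"
        using add one by (intro scale y) (auto simp: add_subgroup_def)
      then show ?thesis using False by (simp add: left_diff_distrib mult.assoc)
    next
      case 2
      then have "(1 - y * inverse x) * x \<in> ?N"
        using add one by (intro scale x) (auto simp: add_subgroup_def)
      then show ?thesis using False by (simp add: left_diff_distrib mult.assoc)
    qed
  qed
  have ideal: "left_ideal W ?N"
    unfolding left_ideal_def add_subgroup_def using scale diff add by (auto simp: add_subgroup_def)
  have "1 \<notin> ?N" using one by simp
  then have ne: "?N \<noteq> W" using one by blast
  have proper: "I \<subseteq> ?N" if I: "left_ideal W I" "I \<noteq> W" for I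
  proof (rule ccontr)
    assume "\<not> I \<subseteq> ?N"
    then obtain x where x: "x \<in> I" "x \<noteq> 0" "inverse x \<in> W" using I by (auto simp: left_ideal_def)
    then have "inverse x * x \<in> I" using I unfolding left_ideal_def by blast
    then have "1 \<in> I" using x by simp
    then have "w \<in> I" if "w \<in> W" for w
      using I(1) that unfolding left_ideal_def by (metis mult.right_neutral)
    with I show False by (auto simp: left_ideal_def)
  qed
  have "maximal_left_ideal W M \<longleftrightarrow> M = ?N" for M
  proof
    assume "maximal_left_ideal W M"
    then show "M = ?N" using proper[of M] ideal ne unfolding maximal_left_ideal_def by blast
  next
    assume "M = ?N"
    then show "maximal_left_ideal W M" using proper ideal ne unfolding maximal_left_ideal_def by blast
  qed
  then show ?thesis unfolding jacobson_def by auto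
qed

locale total_valuation_ring_idempotent =
  fixes W :: "'a::division_ring set"
  assumes W: "total_valuation_ring W" and idempotent: "jacobson W \<odot> jacobson W = jacobson W"
begin

abbreviation "J \<equiv> jacobson W"

lemma add_W: "add_subgroup W" and one_in_W [simp]: "1 \<in> W" and zero_in_W [simp]: "0 \<in> W"
  and mult_in_W: "x \<in> W \<Longrightarrow> y \<in> W \<Longrightarrow> x * y \<in> W"
  and total_in_W: "x \<noteq> 0 \<Longrightarrow> x \<in> W \<or> inverse x \<in> W"
  using W by (auto simp: total_valuation_ring_def is_subring_def add_subgroup_def)

lemma mem_J_iff: "x \<in> J \<longleftrightarrow> x = 0 \<or> inverse x \<notin> W"
  using total_in_W[of x] by (cases "x = 0") (auto simp: jacobson_total_valuation_ring[OF W])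

lemma J_W: "x \<in> J \<Longrightarrow> x \<in> W"
  by (simp add: jacobson_total_valuation_ring[OF W])

lemma J_mult: "x \<in> J \<Longrightarrow> w \<in> W \<Longrightarrow> x * w \<in> J" and W_mult_J: "x \<in> J \<Longrightarrow> w \<in> W \<Longrightarrow> w * x \<in> J"
proof -
  assume x: "x \<in> J" and w: "w \<in> W"
  show "x * w \<in> J"
  proof (cases "x = 0 \<or> w = 0")
    case False
    then have "w * inverse (x * w) = inverse x"
      by (simp add: nonzero_inverse_mult_distrib flip: mult.assoc)
    then have "inverse (x * w) \<notin> W" using mult_in_W[OF w, of "inverse (x * w)"] x False mem_J_iff by metis
    then show ?thesis by (simp add: mem_J_iff)
  qed (auto simp: mem_J_iff)
  show "w * x \<in> J"
  proof (cases "x = 0 \<or> w = 0")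
    case False
    then have "inverse (w * x) * w = inverse x"
      by (simp add: nonzero_inverse_mult_distrib mult.assoc)
    then have "inverse (w * x) \<notin> W" using mult_in_W[OF _ w, of "inverse (w * x)"] x False mem_J_iff by metis
    then show ?thesis by (simp add: mem_J_iff)
  qed (auto simp: mem_J_iff)
qed

lemma add_J: "add_subgroup J"
  by (subst idempotent[symmetric]) (auto simp: set_prod_def add_subgroup_def intro: group_closure.diff)

text \<open>
  From $J \<subseteq> W j$ it would follow that $J = J J \<subseteq> J j$, so that $1 \<in> J$.
\<close>

lemma J_not_principal:
  assumes j: "j \<in> J" "j \<noteq> 0" shows "\<exists>k\<in>J. k * inverse j \<notin> W"
proof (rule ccontr)
  assume n: "\<not> ?thesis"
  have "J \<odot> J \<subseteq> rmul J j"
  proof (rule set_prod_subset)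
    fix a b assume ab: "a \<in> J" "b \<in> J"
    then have "a * (b * inverse j) \<in> J" using n J_mult by blast
    then show "a * b \<in> rmul J j" using j by (simp add: mem_rmul_iff mult.assoc)
  qed (simp add: add_subgroup_rmul add_J)
  then have "j \<in> rmul J j" using j idempotent by auto
  then show False using j by (simp add: mem_rmul_iff mem_J_iff)
qed

text \<open>
  Such an $I$ has $J I = J c$, with left order $W$; and every principal module $W d$ that contains $J c$ contains
  $c$, because $J$ is not principal.
\<close>

lemma star_sandwich:
  assumes ne: "W \<noteq> UNIV" and c: "c \<noteq> 0" and I: "rmul J c \<subseteq> I" "I \<subseteq> rmul W c"
  shows "star (J \<odot> I) = rmul W c"
proof -
  obtain y where y: "y \<notin> W" using ne by blast
  then have "y \<noteq> 0" by auto
  then have y': "inverse y \<in> J" "inverse y \<noteq> 0" using y by (auto simp: mem_J_iff)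
  have prod: "J \<odot> I = rmul J c"
  proof
    show "J \<odot> I \<subseteq> rmul J c"
    proof (rule set_prod_subset)
      fix a b assume "a \<in> J" "b \<in> I"
      then show "a * b \<in> rmul J c" using I c J_mult by (auto simp: mem_rmul_iff mult.assoc)
    qed (simp add: add_subgroup_rmul add_J)
    show "rmul J c \<subseteq> J \<odot> I"
    proof
      fix x assume x: "x \<in> rmul J c"
      show "x \<in> J \<odot> I"
      proof (cases "x = 0")
        case True then show ?thesis by (simp add: set_prod_def)
      next
        case False
        let ?j = "x * inverse c"
        have "?j \<in> J" "?j \<noteq> 0" using x c False by (auto simp: mem_rmul_iff)
        then obtain k where k: "k \<in> J" "k * inverse ?j \<notin> W" using J_not_principal by blast
        then have k0: "k \<noteq> 0" by auto
        have "inverse (k * inverse ?j) = ?j * inverse k" using k0 \<open>?j \<noteq> 0\<close> by (simp add: nonzero_inverse_mult_distrib)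
        then have "?j * inverse k \<in> J" using k by (metis mem_J_iff inverse_inverse_eq)
        moreover have "k * c \<in> I" using k I by (auto simp: rmul_def)
        ultimately have "(?j * inverse k) * (k * c) \<in> J \<odot> I" by (rule set_prod_mem)
        moreover have "(?j * inverse k) * (k * c) = x" using c k0 by (metis mult.assoc left_inverse mult.right_neutral)
        ultimately show ?thesis by simp
      qed
    qed
  qed
  have order: "left_order (rmul J c) = W"
  proof
    show "left_order (rmul J c) \<subseteq> W"
    proof (rule subsetI, rule ccontr)
      fix u assume u: "u \<in> left_order (rmul J c)" "u \<notin> W"
      then have "u \<noteq> 0" "inverse u \<in> J" by (auto simp: mem_J_iff)
      then have "inverse u * c \<in> rmul J c" by (auto simp: rmul_def)
      then have "u * (inverse u * c) \<in> rmul J c" using u by (auto simp: left_order_def lmul_def)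
      then show False using c \<open>u \<noteq> 0\<close> by (simp add: mem_rmul_iff mem_J_iff flip: mult.assoc)
    qed
    show "W \<subseteq> left_order (rmul J c)"
      using c W_mult_J by (auto simp: left_order_def lmul_def mem_rmul_iff mult.assoc)
  qed
  have least: "rmul W c \<subseteq> rmul W d" if d: "rmul J c \<subseteq> rmul W d" for d
  proof (cases "d = 0")
    case True
    have "inverse y * c \<in> rmul W d" using d y' by (auto simp: rmul_def)
    then show ?thesis using True y' c by (auto simp: rmul_def)
  next
    case False
    have "c * inverse d \<in> W"
    proof (rule ccontr)
      assume n: "c * inverse d \<notin> W"
      then have j: "d * inverse c \<in> J" "d * inverse c \<noteq> 0"
        using False c by (auto simp: mem_J_iff nonzero_inverse_mult_distrib)
      obtain k where k: "k \<in> J" "k * inverse (d * inverse c) \<notin> W" using J_not_principal[OF j] by blast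
      have "k * c \<in> rmul W d" using d k by (auto simp: rmul_def)
      then show False using k False c by (simp add: mem_rmul_iff nonzero_inverse_mult_distrib mult.assoc)
    qed
    then show ?thesis using False c mult_in_W by (force simp: rmul_def mult.assoc mem_rmul_iff)
  qed
  have "rmul J c \<subseteq> rmul W c" using J_W by (auto simp: rmul_def)
  then show ?thesis unfolding prod star_def order using least by blast
qed

lemma star_upper:
  assumes st: "star (J \<odot> I) = rmul W c" and c: "c \<noteq> 0"
  shows "I \<subseteq> rmul W c"
proof (rule subsetI, rule ccontr)
  fix x assume x: "x \<in> I" "x \<notin> rmul W c"
  have x0: "x \<noteq> 0" using x c by (auto simp: mem_rmul_iff)
  then have j: "c * inverse x \<in> J" "c * inverse x \<noteq> 0"
    using x c by (auto simp: mem_J_iff mem_rmul_iff nonzero_inverse_mult_distrib)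
  obtain k where k: "k \<in> J" "k * inverse (c * inverse x) \<notin> W" using J_not_principal[OF j] by blast
  have "k * x \<in> star (J \<odot> I)" using set_prod_mem[OF k(1) x(1)] by (auto simp: star_def)
  then show False unfolding st using k c x0 by (simp add: mem_rmul_iff nonzero_inverse_mult_distrib mult.assoc)
qed

text \<open>
  The converse, for $I$ that is bounded by each missing element. An element $z$ of $J c$ missing from $I$ would
  give $J I \<subseteq> W z$, hence $c \<in> W z$. Before that the left order of $J I$ has to be identified as $W$: it
  also stabilises $W c$.
\<close>

lemma sandwich_of_star:
  assumes ne: "W \<noteq> UNIV" and st: "star (J \<odot> I) = rmul W c"
    and I0: "I \<noteq> {0}" "0 \<in> I" and dom: "\<And>y. y \<notin> I \<Longrightarrow> I \<subseteq> rmul W y"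
  shows "c \<noteq> 0" "rmul J c \<subseteq> I" "I \<subseteq> rmul W c"
proof -
  obtain y where y: "y \<notin> W" using ne by blast
  then have "y \<noteq> 0" by auto
  then have y': "inverse y \<in> J" "inverse y \<noteq> 0" using y by (auto simp: mem_J_iff)
  obtain a where a: "a \<in> I" "a \<noteq> 0" using I0 by blast
  have "inverse y * a \<in> star (J \<odot> I)" using set_prod_mem[OF y'(1) a(1)] by (auto simp: star_def)
  then show c: "c \<noteq> 0" unfolding st using a y' by (auto simp: rmul_def)
  show "I \<subseteq> rmul W c" by (rule star_upper[OF st c])
  let ?U = "left_order (J \<odot> I)"
  have U_star: "u * x \<in> star (J \<odot> I)" if u: "u \<in> ?U" and x: "x \<in> star (J \<odot> I)" for u x
  proof -
    have "u * x \<in> rmul ?U d" if d: "J \<odot> I \<subseteq> rmul ?U d" for d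
    proof -
      obtain v where v: "v \<in> ?U" "x = v * d" using x d by (auto simp: star_def rmul_def)
      have "u * v \<in> ?U" using u v by (auto simp: left_order_def lmul_def mult.assoc)
      then show ?thesis using v by (auto simp: rmul_def simp flip: mult.assoc)
    qed
    then show ?thesis by (auto simp: star_def)
  qed
  have "1 * c \<in> rmul W c" unfolding rmul_def using one_in_W by blast
  then have c_star: "c \<in> star (J \<odot> I)" unfolding st by simp
  have U_W: "?U \<subseteq> W"
  proof
    fix u assume "u \<in> ?U"
    from U_star[OF this c_star] show "u \<in> W" unfolding st using c by (simp add: mem_rmul_iff mult.assoc)
  qed
  have W_U: "W \<subseteq> ?U"
  proof
    fix w assume w: "w \<in> W"
    let ?T = "{x. w * x \<in> J \<odot> I}"
    have "J \<odot> I \<subseteq> ?T"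
    proof (rule set_prod_subset)
      show "add_subgroup ?T" by (auto simp: add_subgroup_def set_prod_def right_diff_distrib intro: group_closure.diff)
      fix a b assume "a \<in> J" "b \<in> I"
      then show "a * b \<in> ?T" using set_prod_mem[of "w * a" J b I] W_mult_J[OF _ w] by (simp add: mult.assoc)
    qed
    then show "w \<in> ?U" by (auto simp: left_order_def lmul_def)
  qed
  show "rmul J c \<subseteq> I"
  proof (rule subsetI, rule ccontr)
    fix z assume z: "z \<in> rmul J c" "z \<notin> I"
    then have z0: "z \<noteq> 0" using I0 by auto
    have "J \<odot> I \<subseteq> rmul W z"
    proof (rule set_prod_subset)
      fix a b assume "a \<in> J" "b \<in> I"
      then show "a * b \<in> rmul W z" using dom[OF z(2)] J_W mult_in_W z0 by (auto simp: mem_rmul_iff mult.assoc)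
    qed (simp add: add_subgroup_rmul add_W)
    then have "c \<in> rmul W z" using c_star U_W W_U by (auto simp: star_def)
    then have "c * inverse z \<in> W" using z0 by (simp add: mem_rmul_iff)
    moreover have "inverse (z * inverse c) = c * inverse z" using z0 c by (simp add: nonzero_inverse_mult_distrib)
    ultimately show False using z c z0 by (simp add: mem_rmul_iff mem_J_iff)
  qed
qed

end

section \<open>The group of nonzero homogeneous elements\<close>

text \<open>
  The pair $(a, r)$ stands for $a X^r$.
\<close>

typedef (overloaded) 'a homogeneous = "{x :: 'a::division_ring \<times> rat. fst x \<noteq> 0}"
  by (rule exI[of _ "(1, 0)"]) simp

definition hom :: "'a::division_ring \<Rightarrow> rat \<Rightarrow> 'a homogeneous" where
  "hom a r = Abs_homogeneous (a, r)"

definition coef :: "'a::division_ring homogeneous \<Rightarrow> 'a" where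
  "coef x = fst (Rep_homogeneous x)"

definition hdeg :: "'a::division_ring homogeneous \<Rightarrow> rat" where
  "hdeg x = snd (Rep_homogeneous x)"

lemma hom_simps [simp]: "a \<noteq> 0 \<Longrightarrow> coef (hom a r) = a" "a \<noteq> 0 \<Longrightarrow> hdeg (hom a r) = r"
  by (simp_all add: hom_def coef_def hdeg_def Abs_homogeneous_inverse)

lemma hom_cases [cases type]:
  obtains a r where "a \<noteq> 0" "x = hom a r"
  using Rep_homogeneous[of x] that[of "coef x" "hdeg x"]
  by (simp add: hom_def coef_def hdeg_def Rep_homogeneous_inverse)

lemma hom_eq_iff: "a \<noteq> 0 \<Longrightarrow> b \<noteq> 0 \<Longrightarrow> hom a r = hom b s \<longleftrightarrow> a = b \<and> r = s"
  by (metis hom_simps)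

definition homs :: "(rat \<Rightarrow> 'a::division_ring set) \<Rightarrow> 'a homogeneous set" where
  "homs A = {x. coef x \<in> A (hdeg x)}"

lemma hom_in_homs: "a \<noteq> 0 \<Longrightarrow> hom a r \<in> homs A \<longleftrightarrow> a \<in> A r"
  by (simp add: homs_def)

text \<open>
  The monomials multiply as $(a X^r)(b X^s) = a\, b^{\<sigma>(r)} X^{r+s}$; the group structure depends on the action, so
  it is attached to the action by an interpretation and not by a type class.
\<close>

locale skew_action =
  fixes \<sigma> :: "rat \<Rightarrow> 'a::division_ring \<Rightarrow> 'a"
  assumes aut: "aut_action \<sigma>"
begin

lemma \<sigma>_simps [simp]:
  "\<sigma> r 0 = 0" "\<sigma> r 1 = 1" "\<sigma> r (a * b) = \<sigma> r a * \<sigma> r b" "\<sigma> r (\<sigma> s a) = \<sigma> (r + s) a" "\<sigma> 0 a = a"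
  "\<sigma> r (a - b) = \<sigma> r a - \<sigma> r b"
proof -
  show "\<sigma> r 0 = 0" "\<sigma> 0 a = a" by (rule aut_action_zero[OF aut], rule aut_action_0[OF aut])
  show "\<sigma> r 1 = 1" "\<sigma> r (a * b) = \<sigma> r a * \<sigma> r b" "\<sigma> r (\<sigma> s a) = \<sigma> (r + s) a"
    using aut by (auto simp: aut_action_def ring_automorphism_def)
  have "\<sigma> r ((a - b) + b) = \<sigma> r (a - b) + \<sigma> r b"
    using aut unfolding aut_action_def ring_automorphism_def by blast
  then have "\<sigma> r (a - b) + \<sigma> r b = \<sigma> r a" by simp
  then show "\<sigma> r (a - b) = \<sigma> r a - \<sigma> r b" by (simp add: eq_diff_eq)
qed

lemma \<sigma>_eq_0 [simp]: "\<sigma> r a = 0 \<longleftrightarrow> a = 0"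
  by (metis \<sigma>_simps(1,4,5) add.left_inverse)

lemma \<sigma>_inverse [simp]: "\<sigma> r (inverse a) = inverse (\<sigma> r a)"
proof (cases "a = 0")
  case False
  then have "\<sigma> r (inverse a) * \<sigma> r a = 1" by (metis \<sigma>_simps(2,3) left_inverse)
  then show ?thesis by (metis inverse_unique inverse_inverse_eq)
qed simp

definition hmult :: "'a homogeneous \<Rightarrow> 'a homogeneous \<Rightarrow> 'a homogeneous" where
  "hmult x y = hom (coef x * \<sigma> (hdeg x) (coef y)) (hdeg x + hdeg y)"

definition hinv :: "'a homogeneous \<Rightarrow> 'a homogeneous" where
  "hinv x = hom (\<sigma> (- hdeg x) (inverse (coef x))) (- hdeg x)"

lemma hmult_hom: "a \<noteq> 0 \<Longrightarrow> b \<noteq> 0 \<Longrightarrow> hmult (hom a r) (hom b s) = hom (a * \<sigma> r b) (r + s)"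
  by (simp add: hmult_def)

lemma hinv_hom: "a \<noteq> 0 \<Longrightarrow> hinv (hom a r) = hom (inverse (\<sigma> (- r) a)) (- r)"
  by (simp add: hinv_def)

sublocale homogeneous: group hmult "hom 1 0" hinv
proof
  fix x y z :: "'a homogeneous"
  show "hmult (hmult x y) z = hmult x (hmult y z)"
    by (cases x; cases y; cases z) (simp add: hmult_hom mult.assoc add.assoc)
  show "hmult (hom 1 0) x = x" by (cases x) (simp add: hmult_hom)
  show "hmult (hinv x) x = hom 1 0" by (cases x) (simp add: hmult_hom hinv_hom)
qed

text \<open>
  Graded extensions in terms of monomials: apart from additivity of the components, only products and
  inverses of monomials matter, as products in the skew group ring are sums of such.
\<close>

lemma graded_extension_iff:
  assumes G: "add_subgroup G"
  shows "graded_extension \<sigma> V G A \<longleftrightarrow> (\<forall>r\<in>G. add_subgroup (A r)) \<and> A 0 = V \<and>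
    (\<forall>x\<in>homs A. \<forall>y\<in>homs A. hdeg x \<in> G \<longrightarrow> hdeg y \<in> G \<longrightarrow> hmult x y \<in> homs A) \<and>
    (\<forall>x. hdeg x \<in> G \<longrightarrow> x \<in> homs A \<or> hinv x \<in> homs A)" (is "?L \<longleftrightarrow> ?R")
proof -
  have G0: "0 \<in> G" using G by (simp add: add_subgroup_def)
  have G_minus: "- r \<in> G" if "r \<in> G" for r using add_subgroup_minus[OF G that] .
  have G_add: "r + s \<in> G" if "r \<in> G" "s \<in> G" for r s using add_subgroup_add[OF G that] .
  have single: "Poly_Mapping.single r a \<in> graded_sum G A \<longleftrightarrow> (a = 0 \<or> a \<in> A r)"
    if "r \<in> G" "\<And>s. s \<in> G \<Longrightarrow> 0 \<in> A s" for r a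
    using that by (auto simp: graded_sum_def skew_group_ring_def lookup_single when_def)
  show ?thesis
  proof
    assume L: ?L
    then have A0: "A 0 = V" and sub: "skew_subring \<sigma> G (graded_sum G A)"
      and total: "\<And>r a. r \<in> G \<Longrightarrow> a \<noteq> 0 \<Longrightarrow> Poly_Mapping.single r a \<in> graded_sum G A \<or>
        (\<exists>y\<in>graded_sum G A. skew_mult \<sigma> (Poly_Mapping.single r a) y = skew_one \<and>
                             skew_mult \<sigma> y (Poly_Mapping.single r a) = skew_one)"
      by (auto simp: graded_extension_def graded_total_valuation_ring_def)
    have add: "add_subgroup (graded_sum G A)" using sub by (simp add: skew_subring_def)
    have zero: "0 \<in> A r" if "r \<in> G" for r
    proof -
      have "0 \<in> graded_sum G A" using add by (simp add: add_subgroup_def)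
      then show ?thesis using that by (simp add: graded_sum_def)
    qed
    have add_A: "add_subgroup (A r)" if r: "r \<in> G" for r
    proof -
      have "a - b \<in> A r" if "a \<in> A r" "b \<in> A r" for a b
      proof -
        have "Poly_Mapping.single r a - Poly_Mapping.single r b \<in> graded_sum G A"
          using single[OF r zero] that add by (auto simp: add_subgroup_def)
        then show ?thesis using r by (auto simp: graded_sum_def lookup_minus lookup_single)
      qed
      then show ?thesis using zero[OF r] by (auto simp: add_subgroup_def)
    qed
    have mult: "hmult x y \<in> homs A" if "x \<in> homs A" "y \<in> homs A" "hdeg x \<in> G" "hdeg y \<in> G" for x y
    proof (cases x; cases y)
      fix a r b s assume x: "a \<noteq> 0" "x = hom a r" and y: "b \<noteq> 0" "y = hom b s"
      have rs: "r \<in> G" "s \<in> G" using that x y by auto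
      have "skew_mult \<sigma> (Poly_Mapping.single r a) (Poly_Mapping.single s b) \<in> graded_sum G A"
        using that x y sub single[OF rs(1) zero] single[OF rs(2) zero]
        by (simp add: skew_subring_def hom_in_homs)
      then show ?thesis
        using x y single[OF G_add[OF rs] zero] by (simp add: skew_mult_single[OF aut] hmult_hom hom_in_homs)
    qed
    have tot: "x \<in> homs A \<or> hinv x \<in> homs A" if "hdeg x \<in> G" for x
    proof (cases x)
      fix a r assume x: "a \<noteq> 0" "x = hom a r"
      have r: "r \<in> G" using that x by simp
      consider "a \<in> A r" | y where "y \<in> graded_sum G A" "skew_mult \<sigma> (Poly_Mapping.single r a) y = skew_one"
        using total[OF r x(1)] single[OF r zero] x by auto
      then show ?thesis
      proof cases
        case 2
        let ?i = "Poly_Mapping.single (- r) (\<sigma> (- r) (inverse a))"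
        have "skew_mult \<sigma> ?i (Poly_Mapping.single r a) = skew_one"
          using x by (simp add: skew_mult_single[OF aut])
        then have "skew_mult \<sigma> skew_one y = skew_mult \<sigma> ?i skew_one"
          using skew_mult_assoc[OF aut, of ?i "Poly_Mapping.single r a" y] 2 by simp
        moreover have "skew_mult \<sigma> skew_one y = y"
        proof -
          have "skew_mult \<sigma> skew_one y = (\<Sum>h\<in>Poly_Mapping.keys y. Poly_Mapping.single h (Poly_Mapping.lookup y h))"
            by (simp add: skew_mult_def)
          also have "\<dots> = y"
            by (intro poly_mapping_eqI) (auto simp: lookup_sum lookup_single when_def in_keys_iff)
          finally show ?thesis .
        qed
        moreover have "skew_mult \<sigma> ?i skew_one = ?i"
          by (subst skew_mult_single[OF aut]) simp
        ultimately have "y = ?i" by metis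
        then have "\<sigma> (- r) (inverse a) \<in> A (- r)" using 2 single[OF G_minus[OF r] zero] x by auto
        then show ?thesis using x by (simp add: hinv_hom hom_in_homs)
      qed (use x in \<open>simp add: hom_in_homs\<close>)
    qed
    show ?R using add_A A0 mult tot by blast
  next
    assume R: ?R
    then have add_A: "\<And>r. r \<in> G \<Longrightarrow> add_subgroup (A r)" by blast
    then have zero: "0 \<in> A r" if "r \<in> G" for r using that by (simp add: add_subgroup_def)
    have "hom 1 0 \<in> homs A" using R G0 hinv_hom[of 1 0] by (metis hom_simps(2) zero_neq_one \<sigma>_simps(2) inverse_1 minus_zero)
    then have one: "1 \<in> A 0" by (simp add: hom_in_homs)
    have mult: "a * \<sigma> r b \<in> A (r + s)" if "a \<in> A r" "b \<in> A s" "r \<in> G" "s \<in> G" for a b r s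
    proof (cases "a = 0 \<or> b = 0")
      case True then show ?thesis using zero[OF G_add] that by auto
    next
      case False
      then have "hmult (hom a r) (hom b s) \<in> homs A" using R that by (simp add: hom_in_homs)
      then show ?thesis using False by (simp add: hmult_hom hom_in_homs)
    qed
    have add: "add_subgroup (graded_sum G A)"
      unfolding add_subgroup_def
    proof (intro conjI ballI)
      show "0 \<in> graded_sum G A" using zero by (simp add: graded_sum_def skew_group_ring_def)
      fix p q assume pq: "p \<in> graded_sum G A" "q \<in> graded_sum G A"
      then have "Poly_Mapping.keys (p - q) \<subseteq> G"
        using keys_diff[of p q] by (auto simp: graded_sum_def skew_group_ring_def)
      then show "p - q \<in> graded_sum G A"
        using pq add_A by (auto simp: graded_sum_def skew_group_ring_def lookup_minus add_subgroup_def)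
    qed
    have "skew_mult \<sigma> p q \<in> graded_sum G A" if pq: "p \<in> graded_sum G A" "q \<in> graded_sum G A" for p q
      unfolding skew_mult_def
    proof (intro add_subgroup_sum[OF add])
      fix r s assume "r \<in> Poly_Mapping.keys p" "s \<in> Poly_Mapping.keys q"
      then have rs: "r \<in> G" "s \<in> G" using pq by (auto simp: graded_sum_def skew_group_ring_def)
      then show "Poly_Mapping.single (r + s) (Poly_Mapping.lookup p r * \<sigma> r (Poly_Mapping.lookup q s)) \<in> graded_sum G A"
        using single[OF G_add[OF rs] zero] mult[of "Poly_Mapping.lookup p r" r "Poly_Mapping.lookup q s" s] pq
        by (auto simp: graded_sum_def)
    qed
    moreover have "skew_one \<in> graded_sum G A" using single[OF G0 zero] one by blast
    moreover have "graded_sum G A \<subseteq> skew_group_ring G" by (auto simp: graded_sum_def)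
    moreover have "Poly_Mapping.single r a \<in> graded_sum G A \<or>
        (\<exists>y\<in>graded_sum G A. skew_mult \<sigma> (Poly_Mapping.single r a) y = skew_one \<and>
                             skew_mult \<sigma> y (Poly_Mapping.single r a) = skew_one)"
      if r: "r \<in> G" and a: "a \<noteq> 0" for r a
    proof -
      have "hom a r \<in> homs A \<or> hinv (hom a r) \<in> homs A" using R r a by simp
      then have "a \<in> A r \<or> inverse (\<sigma> (- r) a) \<in> A (- r)" using a by (simp add: hinv_hom hom_in_homs)
      then show ?thesis
      proof
        assume "inverse (\<sigma> (- r) a) \<in> A (- r)"
        then have "Poly_Mapping.single (- r) (inverse (\<sigma> (- r) a)) \<in> graded_sum G A"
          using single[OF G_minus[OF r] zero] by simp
        then show ?thesis using a
          by (intro disjI2 bexI[of _ "Poly_Mapping.single (- r) (inverse (\<sigma> (- r) a))"])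
            (simp_all add: skew_mult_single[OF aut])
      qed (use single[OF r zero] in simp)
    qed
    ultimately show ?L using R add by (auto simp: graded_extension_def graded_total_valuation_ring_def skew_subring_def)
  qed
qed

end

locale skew_valuation = skew_action \<sigma> + total_valuation_ring_idempotent W
  for \<sigma> :: "rat \<Rightarrow> 'a::division_ring \<Rightarrow> 'a" and W :: "'a set"
begin

definition homW :: "'a homogeneous set" where "homW = {x. hdeg x = 0 \<and> coef x \<in> W}"

lemma hom_in_homW: "a \<noteq> 0 \<Longrightarrow> hom a r \<in> homW \<longleftrightarrow> r = 0 \<and> a \<in> W"
  by (auto simp: homW_def)

sublocale valued_group hmult "hom 1 0" hinv hdeg homW
proof
  fix x y :: "'a homogeneous"
  show "hdeg (hmult x y) = hdeg x + hdeg y" by (cases x; cases y) (simp add: hmult_hom)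
  show "x \<in> homW \<Longrightarrow> hdeg x = 0" by (simp add: homW_def)
  show "x \<in> homW \<Longrightarrow> y \<in> homW \<Longrightarrow> hmult x y \<in> homW"
    by (cases x; cases y) (auto simp: hmult_hom hom_in_homW mult_in_W)
  show "hdeg x = 0 \<Longrightarrow> x \<in> homW \<or> hinv x \<in> homW"
    using total_in_W by (cases x) (simp add: hinv_hom hom_in_homW)
  show "\<exists>k\<in>homW. hinv k \<notin> homW \<and> hmult k (hinv x) \<notin> homW" if "x \<in> homW" "hinv x \<notin> homW"
  proof (cases x)
    fix a r assume x: "a \<noteq> 0" "x = hom a r"
    then have a: "r = 0" "a \<in> J" using that by (auto simp: hom_in_homW hinv_hom mem_J_iff)
    obtain k where k: "k \<in> J" "k * inverse a \<notin> W" using J_not_principal[OF a(2) x(1)] by blast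
    then have "k \<noteq> 0" by auto
    then show ?thesis using k x a J_W[OF k(1)]
      by (intro bexI[of _ "hom k 0"]) (auto simp: hom_in_homW hinv_hom hmult_hom mem_J_iff)
  qed
qed

lemma hom_in_rad: "a \<noteq> 0 \<Longrightarrow> hom a r \<in> rad \<longleftrightarrow> r = 0 \<and> a \<in> J"
  by (auto simp: rad_def hinv_hom hom_in_homW mem_J_iff)

lemma quotient_hom: "a \<noteq> 0 \<Longrightarrow> c \<noteq> 0 \<Longrightarrow> hmult (hom a r) (hinv (hom c r)) = hom (a * inverse c) 0"
  by (simp add: hinv_hom hmult_hom)

text \<open>
  The zero element is the only difference between the two sides.
\<close>

lemma sandwich_homs_iff:
  assumes "c \<noteq> 0" "0 \<in> A r"
  shows "sandwich (homs A) (hom c r) \<longleftrightarrow> rmul J c \<subseteq> A r \<and> A r \<subseteq> rmul W c"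
proof -
  have "(\<forall>j\<in>rad. hmult j (hom c r) \<in> homs A) \<longleftrightarrow> (\<forall>a. a \<noteq> 0 \<longrightarrow> a \<in> J \<longrightarrow> a * c \<in> A r)"
  proof (intro iffI allI impI ballI)
    fix a assume *: "\<forall>j\<in>rad. hmult j (hom c r) \<in> homs A" and a: "a \<noteq> 0" "a \<in> J"
    then have "hmult (hom a 0) (hom c r) \<in> homs A" by (simp add: hom_in_rad)
    then show "a * c \<in> A r" using a assms by (simp add: hmult_hom hom_in_homs)
  next
    fix j assume *: "\<forall>a. a \<noteq> 0 \<longrightarrow> a \<in> J \<longrightarrow> a * c \<in> A r" and j: "j \<in> rad"
    then show "hmult j (hom c r) \<in> homs A"
      using assms by (cases j) (auto simp: hmult_hom hom_in_homs hom_in_rad)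
  qed
  moreover have "(\<forall>a. a \<noteq> 0 \<longrightarrow> a \<in> J \<longrightarrow> a * c \<in> A r) \<longleftrightarrow> rmul J c \<subseteq> A r"
    using assms by (auto simp: rmul_def) (metis mult_zero_left)
  moreover have "(\<forall>x\<in>homs A. hdeg x = hdeg (hom c r) \<longrightarrow> hmult x (hinv (hom c r)) \<in> homW) \<longleftrightarrow> (\<forall>a. a \<noteq> 0 \<longrightarrow> a \<in> A r \<longrightarrow> a * inverse c \<in> W)"
  proof (intro iffI allI impI ballI)
    fix a assume *: "\<forall>x\<in>homs A. hdeg x = hdeg (hom c r) \<longrightarrow> hmult x (hinv (hom c r)) \<in> homW" and a: "a \<noteq> 0" "a \<in> A r"
    then have "hmult (hom a r) (hinv (hom c r)) \<in> homW" using assms by (simp add: hom_in_homs)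
    then show "a * inverse c \<in> W" using a assms by (simp add: quotient_hom hom_in_homW)
  next
    fix x assume *: "\<forall>a. a \<noteq> 0 \<longrightarrow> a \<in> A r \<longrightarrow> a * inverse c \<in> W" and x: "x \<in> homs A" "hdeg x = hdeg (hom c r)"
    then show "hmult x (hinv (hom c r)) \<in> homW"
      using assms by (cases x) (auto simp: quotient_hom hom_in_homs hom_in_homW)
  qed
  moreover have "(\<forall>a. a \<noteq> 0 \<longrightarrow> a \<in> A r \<longrightarrow> a * inverse c \<in> W) \<longleftrightarrow> A r \<subseteq> rmul W c"
    using assms by (auto simp: mem_rmul_iff subset_iff) (metis mult_zero_left zero_in_W)
  ultimately show ?thesis unfolding sandwich_def by simp
qed

end

context skew_valuation
begin

lemma rmul_W_eq_iff:
  assumes "a \<noteq> 0" "b \<noteq> 0"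
  shows "rmul W a = rmul W b \<longleftrightarrow> a * inverse b \<in> W \<and> b * inverse a \<in> W"
proof
  assume *: "rmul W a = rmul W b"
  have "1 * a \<in> rmul W a" "1 * b \<in> rmul W b" unfolding rmul_def using one_in_W by blast+
  then have "a \<in> rmul W b" "b \<in> rmul W a" using * by simp_all
  then show "a * inverse b \<in> W \<and> b * inverse a \<in> W" using assms by (simp add: mem_rmul_iff)
next
  have *: "rmul W a \<subseteq> rmul W b" if "a * inverse b \<in> W" "a \<noteq> 0" "b \<noteq> 0" for a b
    using that mult_in_W by (auto simp: rmul_def[of _ a] mem_rmul_iff mult.assoc)
  assume "a * inverse b \<in> W \<and> b * inverse a \<in> W"
  then show "rmul W a = rmul W b" using * assms by blast
qed

lemma assoc_eq_hom_iff:
  "a \<noteq> 0 \<Longrightarrow> b \<noteq> 0 \<Longrightarrow> assoc_eq (hom a r) (hom b r) \<longleftrightarrow> rmul W a = rmul W b"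
  by (simp add: assoc_eq_def quotient_hom hom_in_homW rmul_W_eq_iff)

lemma normalizes_W_hom_iff:
  assumes c: "c \<noteq> 0"
  shows "normalizes_W (hom c s) \<longleftrightarrow> rmul W c = lmul c (\<sigma> s ` W)"
proof -
  have conj: "hmult (hmult (hom c s) (hom w 0)) (hinv (hom c s)) = hom (c * \<sigma> s w * inverse c) 0"
    "hmult (hmult (hinv (hom c s)) (hom w 0)) (hom c s) = hom (\<sigma> (- s) (inverse c * w * c)) 0" if "w \<noteq> 0" for w
    using c that by (simp_all add: hmult_hom hinv_hom mult.assoc)
  have "normalizes_W (hom c s) \<longleftrightarrow>
    (\<forall>w\<in>W. w \<noteq> 0 \<longrightarrow> c * \<sigma> s w * inverse c \<in> W \<and> \<sigma> (- s) (inverse c * w * c) \<in> W)" (is "_ \<longleftrightarrow> ?C")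
  proof
    assume n: "normalizes_W (hom c s)"
    show ?C
    proof (intro ballI impI)
      fix w assume w: "w \<in> W" "w \<noteq> 0"
      then have "hom w 0 \<in> homW" by (simp add: hom_in_homW)
      then have "hom (c * \<sigma> s w * inverse c) 0 \<in> homW \<and> hom (\<sigma> (- s) (inverse c * w * c)) 0 \<in> homW"
        using n unfolding normalizes_W_def conj[OF w(2), symmetric] by blast
      then show "c * \<sigma> s w * inverse c \<in> W \<and> \<sigma> (- s) (inverse c * w * c) \<in> W"
        using w c by (simp add: hom_in_homW del: \<sigma>_simps)
    qed
  next
    assume C: ?C
    show "normalizes_W (hom c s)" unfolding normalizes_W_def
    proof
      fix u assume u: "u \<in> homW"
      show "hmult (hmult (hom c s) u) (hinv (hom c s)) \<in> homW \<and> hmult (hmult (hinv (hom c s)) u) (hom c s) \<in> homW"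
      proof (cases u)
        fix a r assume a: "a \<noteq> 0" "u = hom a r"
        then have "r = 0" "a \<in> W" using u by (simp_all add: hom_in_homW)
        moreover have "c * \<sigma> s a * inverse c \<noteq> 0" "\<sigma> (- s) (inverse c * a * c) \<noteq> 0" using a c by simp_all
        ultimately show ?thesis using C a unfolding a(2) \<open>r = 0\<close> conj[OF a(1)] by (simp add: hom_in_homW del: \<sigma>_simps)
      qed
    qed
  qed
  also have "\<dots> \<longleftrightarrow> rmul W c = lmul c (\<sigma> s ` W)"
  proof
    assume C: ?C
    show "rmul W c = lmul c (\<sigma> s ` W)"
    proof (intro equalityI subsetI)
      fix x assume "x \<in> rmul W c"
      then obtain w where w: "w \<in> W" "x = w * c" by (auto simp: rmul_def)
      have "\<sigma> (- s) (inverse c * w * c) \<in> W" using C w by (cases "w = 0") auto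
      moreover have "x = c * \<sigma> s (\<sigma> (- s) (inverse c * w * c))" using w c by (simp flip: mult.assoc)
      ultimately show "x \<in> lmul c (\<sigma> s ` W)" unfolding lmul_def by blast
    next
      fix x assume "x \<in> lmul c (\<sigma> s ` W)"
      then obtain w where w: "w \<in> W" "x = c * \<sigma> s w" by (auto simp: lmul_def)
      have "c * \<sigma> s w * inverse c \<in> W" using C w by (cases "w = 0") auto
      then show "x \<in> rmul W c" using c w by (simp add: mem_rmul_iff)
    qed
  next
    assume eq: "rmul W c = lmul c (\<sigma> s ` W)"
    show ?C
    proof (intro ballI impI)
      fix w assume w: "w \<in> W" "w \<noteq> 0"
      have "c * \<sigma> s w \<in> rmul W c" unfolding eq lmul_def using w by blast
      moreover have "w * c \<in> lmul c (\<sigma> s ` W)" unfolding eq[symmetric] rmul_def using w by blast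
      then obtain v where v: "v \<in> W" "w * c = c * \<sigma> s v" by (auto simp: lmul_def)
      have "\<sigma> (- s) (inverse c * w * c) = v" using v c by (simp add: mult.assoc) (simp flip: mult.assoc)
      ultimately show "c * \<sigma> s w * inverse c \<in> W \<and> \<sigma> (- s) (inverse c * w * c) \<in> W"
        using v c by (simp add: mem_rmul_iff)
    qed
  qed
  finally show ?thesis .
qed

text \<open>
  The components of the ring $M$ of the theorem.
\<close>

definition companion_family :: "rat set \<Rightarrow> (rat \<Rightarrow> 'a) \<Rightarrow> 'a set \<Rightarrow> (rat \<Rightarrow> 'a set) \<Rightarrow> rat \<Rightarrow> 'a set" where
  "companion_family H c V A = (\<lambda>r. if r = 0 then V
      else if r \<in> H then (if r < 0 then rmul W (c r) else rmul J (c r)) else A r)"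

lemma homs_companion_family:
  assumes c: "\<And>s. s \<in> H \<Longrightarrow> c s \<noteq> 0" and V: "A 0 = V"
  shows "homs (companion_family H c V A) = companion H (\<lambda>s. hom (c s) s) (homs A)"
proof (rule set_eqI)
  fix x show "x \<in> homs (companion_family H c V A) \<longleftrightarrow> x \<in> companion H (\<lambda>s. hom (c s) s) (homs A)"
  proof (cases x)
    fix a r assume x: "a \<noteq> 0" "x = hom a r"
    show ?thesis
      using x V c[of r]
      by (cases "r \<in> H") (auto simp: companion_family_def hom_in_homs companion_def quotient_hom hom_in_homW hom_in_rad mem_rmul_iff)
  qed
qed

end

section \<open>Graded families and Type (h)\<close>

locale graded_family = skew_valuation \<sigma> W
  for \<sigma> :: "rat \<Rightarrow> 'a::division_ring \<Rightarrow> 'a" and W :: "'a set" +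
  fixes V :: "'a set" and A :: "rat \<Rightarrow> 'a set"
  assumes A_subgroup: "add_subgroup (A r)" and A_0: "A 0 = V" and V_subset_W: "V \<subset> W"
    and W_eq_Union: "W = (\<Union>r. left_order (A r))" and W_attained: "\<exists>t. left_order (A t) = W"
begin

lemma zero_in_A [simp]: "0 \<in> A r"
  using A_subgroup[of r] by (simp add: add_subgroup_def)

lemma left_order_iff: "a \<in> left_order (A r) \<longleftrightarrow> (\<forall>x\<in>A r. a * x \<in> A r)"
  by (auto simp: left_order_def lmul_def)

lemma homs_degree_0: "x \<in> homs A \<Longrightarrow> hdeg x = 0 \<Longrightarrow> x \<in> homW"
  using A_0 V_subset_W by (cases x) (auto simp: hom_in_homs hom_in_homW)

lemma not_homW_subset: "\<not> homW \<subseteq> homs A"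
proof -
  obtain w where w: "w \<in> W" "w \<notin> V" using V_subset_W by blast
  then have "w \<noteq> 0" using A_0 zero_in_A by metis
  then have "hom w 0 \<in> homW" "hom w 0 \<notin> homs A" using w A_0 by (simp_all add: hom_in_homs hom_in_homW)
  then show ?thesis by blast
qed

lemma bounded_cone_homs:
  assumes ge: "graded_extension \<sigma> V UNIV A"
  shows "bounded_cone hmult (hom 1 0) hinv hdeg homW (homs A)"
proof -
  have UNIV: "add_subgroup (UNIV :: rat set)" by (simp add: add_subgroup_def)
  note ge' = ge[unfolded graded_extension_iff[OF UNIV]]
  show ?thesis
  proof unfold_locales
    fix x y u r assume *: "hdeg u = (0::rat)" "\<And>x. x \<in> homs A \<Longrightarrow> hdeg x = r \<Longrightarrow> hmult u x \<in> homs A"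
    show "u \<in> homW"
    proof (cases u)
      fix a s assume a: "a \<noteq> 0" "u = hom a s"
      have "a * x \<in> A r" if x: "x \<in> A r" for x
      proof (cases "x = 0")
        case False
        then have "hmult u (hom x r) \<in> homs A" using x by (intro *(2)) (simp_all add: hom_in_homs)
        then show ?thesis using a False *(1) by (simp add: hmult_hom hom_in_homs)
      qed simp
      then have "a \<in> left_order (A r)" by (simp add: left_order_iff)
      then have "a \<in> W" using W_eq_Union by blast
      then show ?thesis using a *(1) by (simp add: hom_in_homW)
    qed
  next
    obtain t where t: "left_order (A t) = W" using W_attained by blast
    show "\<exists>t. \<forall>w\<in>homW. \<forall>x\<in>homs A. hdeg x = t \<longrightarrow> hmult w x \<in> homs A"
    proof (intro exI[of _ t] ballI impI)
      fix w x assume w: "w \<in> homW" and x: "x \<in> homs A" "hdeg x = t"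
      show "hmult w x \<in> homs A"
      proof (cases w; cases x)
        fix a r b s assume a: "a \<noteq> 0" "w = hom a r" and b: "b \<noteq> 0" "x = hom b s"
        then have "r = 0" "a \<in> left_order (A t)" "s = t" "b \<in> A t" using w x t by (simp_all add: hom_in_homW hom_in_homs)
        then show ?thesis using a b by (simp add: hmult_hom hom_in_homs left_order_iff)
      qed
    qed
  qed (use ge' homs_degree_0 not_homW_subset in auto)
qed

end

locale graded_extension_family = graded_family +
  assumes ge: "graded_extension \<sigma> V UNIV A"
begin

sublocale bounded_cone hmult "hom 1 0" hinv hdeg homW "homs A"
  by (rule bounded_cone_homs[OF ge])

lemma A_mult: "a \<in> A r \<Longrightarrow> b \<in> A s \<Longrightarrow> a * \<sigma> r b \<in> A (r + s)"
proof (cases "a = 0 \<or> b = 0")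
  case False
  assume "a \<in> A r" "b \<in> A s"
  then have "hmult (hom a r) (hom b s) \<in> homs A" using False by (intro mult_P) (simp_all add: hom_in_homs)
  then show ?thesis using False by (simp add: hmult_hom hom_in_homs)
qed auto

lemma hom_sandwich_degrees: "c \<noteq> 0 \<Longrightarrow> sandwiched (hom c r) \<Longrightarrow> r \<in> sandwich_degrees"
  unfolding sandwich_degrees_def by (rule image_eqI[of _ _ "hom c r"]) simp_all

lemma A_dominated:
  assumes y: "y \<notin> A r" shows "A r \<subseteq> rmul W y"
proof
  fix x assume x: "x \<in> A r"
  have y0: "y \<noteq> 0" using y by auto
  show "x \<in> rmul W y"
  proof (cases "x = 0")
    case False
    then have "hmult (hom x r) (hinv (hom y r)) \<in> homs A"
      using quotient_in_P[of "hom x r" "hom y r"] x y y0 by (simp add: hom_in_homs)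
    then have "hmult (hom x r) (hinv (hom y r)) \<in> homW" by (rule P_degree_0) (use False y0 in simp)
    then show ?thesis using False y0 by (simp add: quotient_hom hom_in_homW mem_rmul_iff)
  qed (use y0 in \<open>simp add: mem_rmul_iff\<close>)
qed

lemma sandwiched_of_star:
  assumes "W \<noteq> UNIV" and st: "star (J \<odot> A r) = rmul W c"
  shows "c \<noteq> 0" "sandwiched (hom c r)"
proof -
  have "A r \<noteq> {0}"
  proof
    assume "A r = {0}"
    then have "left_order (A r) = UNIV" by (auto simp: left_order_def lmul_def)
    then show False using W_eq_Union assms(1) by blast
  qed
  note * = sandwich_of_star[OF assms this zero_in_A A_dominated]
  then show "c \<noteq> 0" by blast
  then show "sandwiched (hom c r)" using * by (simp add: sandwich_homs_iff)
qed

lemma star_of_sandwiched: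
  assumes "W \<noteq> UNIV" "c \<noteq> 0" "sandwiched (hom c r)"
  shows "star (J \<odot> A r) = rmul W c"
  using assms by (intro star_sandwich) (auto simp: sandwich_homs_iff)

lemma star_degrees:
  assumes "W \<noteq> UNIV"
  shows "{r. \<exists>c. star (J \<odot> A r) = rmul W c} = sandwich_degrees"
proof (rule set_eqI)
  fix r
  have "(\<exists>c. star (J \<odot> A r) = rmul W c) \<longleftrightarrow> (\<exists>c. c \<noteq> 0 \<and> sandwiched (hom c r))"
    using sandwiched_of_star star_of_sandwiched assms by blast
  also have "\<dots> \<longleftrightarrow> (\<exists>g. sandwiched g \<and> hdeg g = r)"
    by (metis hom_simps(2) hom_cases)
  also have "\<dots> \<longleftrightarrow> r \<in> sandwich_degrees" by (auto simp: sandwich_degrees_def)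
  finally show "r \<in> {r. \<exists>c. star (J \<odot> A r) = rmul W c} \<longleftrightarrow> r \<in> sandwich_degrees" by simp
qed

lemma set_prod_eq:
  assumes *: "\<And>z. z \<in> homs A \<Longrightarrow> hdeg z = a + b \<Longrightarrow> \<exists>x\<in>homs A. \<exists>y\<in>homs A. hdeg x = a \<and> hdeg y = b \<and> z = hmult x y"
  shows "A a \<odot> \<sigma> a ` A b = A (a + b)"
proof
  show "A a \<odot> \<sigma> a ` A b \<subseteq> A (a + b)" by (rule set_prod_subset[OF A_subgroup]) (auto intro: A_mult)
  show "A (a + b) \<subseteq> A a \<odot> \<sigma> a ` A b"
  proof
    fix z assume z: "z \<in> A (a + b)"
    show "z \<in> A a \<odot> \<sigma> a ` A b"
    proof (cases "z = 0")
      case False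
      then obtain g h where gh: "g \<in> homs A" "h \<in> homs A" "hdeg g = a" "hdeg h = b" "hom z (a + b) = hmult g h"
        using *[of "hom z (a + b)"] z by (auto simp: hom_in_homs)
      show ?thesis
      proof (cases g; cases h)
        fix x r y s assume x: "x \<noteq> 0" "g = hom x r" and y: "y \<noteq> 0" "h = hom y s"
        then have "x \<in> A a" "y \<in> A b" "z = x * \<sigma> a y" using gh False by (simp_all add: hom_in_homs hmult_hom hom_eq_iff)
        then show ?thesis using set_prod_mem by blast
      qed
    qed (simp add: set_prod_def)
  qed
qed

text \<open>
  If $H$ were everything or only \<open>{0}\<close>, then all components of equal sign would multiply as in Type (I).
  In the second case this uses that a sum of two degrees of equal sign is not $0$.
\<close>

lemma type_II_sandwich_degrees:
  assumes II: "graded_extension_type_II \<sigma> V G A"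
  shows "sandwich_degrees \<noteq> UNIV" "sandwich_degrees \<noteq> {0}"
proof -
  have *: "\<not> graded_extension_type_II \<sigma> V G A"
    if products: "\<And>a b z. a * b > 0 \<Longrightarrow> z \<in> homs A \<Longrightarrow> hdeg z = a + b \<Longrightarrow> \<exists>x\<in>homs A. \<exists>y\<in>homs A. hdeg x = a \<and> hdeg y = b \<and> z = hmult x y"
  proof -
    have eq: "A a \<odot> \<sigma> a ` A b = A (a + b)" if "a * b > 0" for a b
      by (rule set_prod_eq) (rule products[OF that])
    have "A (- g) \<odot> \<sigma> (- g) ` A (- h) = A (- g - h)" if "g > 0" "h > 0" for g h
      using eq[of "-g" "-h"] that by simp
    then show ?thesis using eq by (auto simp: graded_extension_type_II_def)
  qed
  show "sandwich_degrees \<noteq> UNIV"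
  proof
    assume "sandwich_degrees = UNIV"
    from *[OF product_decomposition_if_all_sandwiched[OF this]] II show False by blast
  qed
  show "sandwich_degrees \<noteq> {0}"
  proof
    assume "sandwich_degrees = {0}"
    moreover have "a + b \<noteq> 0" if "a * b > 0" for a b :: rat
      using that by (auto simp: zero_less_mult_iff)
    ultimately have "\<exists>x\<in>homs A. \<exists>y\<in>homs A. hdeg x = a \<and> hdeg y = b \<and> z = hmult x y"
      if "a * b > 0" "z \<in> homs A" "hdeg z = a + b" for a b z
      using product_decomposition[OF that(2,3)] that(1) by simp
    then show False using * II by blast
  qed
qed

text \<open>
  For $W = K$ the radical is $0$ and every element is sandwiched.
\<close>

lemma type_II_W_proper:
  assumes "graded_extension_type_II \<sigma> V G A" shows "W \<noteq> UNIV"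
proof
  assume W: "W = UNIV"
  have J: "x \<in> J \<longleftrightarrow> x = 0" for x using mem_J_iff[of x] W by simp
  have "rmul J 1 \<subseteq> A r" "A r \<subseteq> rmul W 1" for r using J W by (auto simp: rmul_def)
  then have "sandwiched (hom 1 r)" for r by (simp add: sandwich_homs_iff)
  then have "r \<in> sandwich_degrees" for r using hom_sandwich_degrees[of 1] by simp
  then show False using type_II_sandwich_degrees[OF assms] by blast
qed

lemma off_sandwich_degrees:
  assumes ne: "W \<noteq> UNIV" and s: "s \<notin> sandwich_degrees"
  shows "left_order (A s) = W" "star (A s) = A s" "A s = W \<odot> A s" "\<nexists>d. A s = rmul W d" "right_order (A s) = \<sigma> s ` W"
proof -
  have stable: "w * x \<in> A s" "x * \<sigma> s w \<in> A s" if "w \<in> W" "x \<in> A s" for w x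
  proof -
    have "w * x \<in> A s \<and> x * \<sigma> s w \<in> A s"
    proof (cases "w = 0 \<or> x = 0")
      case False
      then have "hmult (hom w 0) (hom x s) \<in> homs A" "hmult (hom x s) (hom w 0) \<in> homs A"
        using that s False W_stable[of "hom x s" "hom w 0"] W_right_stable[of "hom x s" "hom w 0"]
        by (simp_all add: hom_in_homs hom_in_homW)
      then show ?thesis using False by (simp add: hmult_hom hom_in_homs)
    qed auto
    then show "w * x \<in> A s" "x * \<sigma> s w \<in> A s" by blast+
  qed
  show order: "left_order (A s) = W"
  proof
    show "left_order (A s) \<subseteq> W" using W_eq_Union by blast
    show "W \<subseteq> left_order (A s)" using stable by (auto simp: left_order_iff)
  qed
  show "star (A s) = A s"
  proof
    show "A s \<subseteq> star (A s)" by (auto simp: star_def)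
    show "star (A s) \<subseteq> A s"
    proof (rule subsetI, rule ccontr)
      fix x assume x: "x \<in> star (A s)" "x \<notin> A s"
      have x0: "x \<noteq> 0" using x by auto
      obtain g where g: "g \<notin> homs A" "hdeg g = s" "hmult (hom x s) (hinv g) \<notin> homW"
        using intersection_of_principal[of "hom x s"] s x x0 by (auto simp: hom_in_homs)
      show False
      proof (cases g)
        fix y r assume y: "y \<noteq> 0" "g = hom y r"
        then have "y \<notin> A s" "x \<notin> rmul W y" using g x0 by (simp_all add: hom_in_homs quotient_hom hom_in_homW mem_rmul_iff)
        then show False using A_dominated[of y s] x order by (auto simp: star_def)
      qed
    qed
  qed
  show "A s = W \<odot> A s"
  proof
    show "W \<odot> A s \<subseteq> A s" by (rule set_prod_subset[OF A_subgroup]) (rule stable)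
    show "A s \<subseteq> W \<odot> A s" using set_prod_mem[OF one_in_W, of _ "A s"] by auto
  qed
  show "\<nexists>d. A s = rmul W d"
  proof
    assume "\<exists>d. A s = rmul W d"
    then obtain d where d: "A s = rmul W d" by blast
    show False
    proof (cases "d = 0")
      case True
      then have "left_order (A s) = UNIV" using d one_in_W by (auto simp: left_order_def lmul_def rmul_def)
      then show False using order ne by simp
    next
      case False
      have "rmul J d \<subseteq> A s" "A s \<subseteq> rmul W d" using d J_W by (auto simp: rmul_def)
      then have "sandwiched (hom d s)" by (simp add: sandwich_homs_iff False)
      then show False using s hom_sandwich_degrees False by blast
    qed
  qed
  show "right_order (A s) = \<sigma> s ` W"
  proof
    show "\<sigma> s ` W \<subseteq> right_order (A s)" using stable by (auto simp: right_order_def rmul_def)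
    show "right_order (A s) \<subseteq> \<sigma> s ` W"
    proof
      fix a assume a: "a \<in> right_order (A s)"
      have "\<sigma> (- s) a \<in> W"
      proof (cases "a = 0")
        case False
        have "hom (\<sigma> (- s) a) 0 \<in> homW"
        proof (rule right_stabilizer_W[where r = s])
          fix x assume x: "x \<in> homs A" "hdeg x = s"
          then show "hmult x (hom (\<sigma> (- s) a) 0) \<in> homs A"
            using a False by (cases x) (auto simp: hmult_hom hom_in_homs right_order_def rmul_def)
        qed (use False in simp)
        then show ?thesis using False by (simp add: hom_in_homW)
      qed simp
      then have "\<sigma> s (\<sigma> (- s) a) \<in> \<sigma> s ` W" by blast
      then show "a \<in> \<sigma> s ` W" by simp
    qed
  qed
qed

lemma rmul_product:
  assumes g: "c \<noteq> 0" "sandwiched (hom c r)" and h: "d \<noteq> 0" "sandwiched (hom d s)"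
    and e: "e \<noteq> 0" "sandwiched (hom e (r + s))"
  shows "rmul W c \<odot> \<sigma> r ` rmul W d = rmul W e"
proof -
  have "assoc_eq (hom (c * \<sigma> r d) (r + s)) (hom e (r + s))"
    using sandwiched_unique[OF _ e(2), of "hom (c * \<sigma> r d) (r + s)"] sandwiched_mult[OF g(2) h(2)] g h e
    by (simp add: hmult_hom)
  then have eq: "rmul W e = rmul W (c * \<sigma> r d)" using g h e by (simp add: assoc_eq_hom_iff)
  have norm: "rmul W c = lmul c (\<sigma> r ` W)"
    using sandwiched_normalizes[OF g(2)] g(1) by (simp add: normalizes_W_hom_iff)
  show ?thesis unfolding eq
  proof
    show "rmul W c \<odot> \<sigma> r ` rmul W d \<subseteq> rmul W (c * \<sigma> r d)"
    proof (rule set_prod_subset)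
      fix a b assume a: "a \<in> rmul W c" and b: "b \<in> \<sigma> r ` rmul W d"
      then obtain v w where v: "v \<in> W" "a = v * c" and w: "w \<in> W" "b = \<sigma> r w * \<sigma> r d" by (auto simp: rmul_def)
      have "c * \<sigma> r w \<in> rmul W c" unfolding norm lmul_def using w by blast
      then obtain u where u: "u \<in> W" "c * \<sigma> r w = u * c" by (auto simp: rmul_def)
      have "a * b = v * (c * \<sigma> r w) * \<sigma> r d" using v w by (simp add: mult.assoc)
      also have "\<dots> = (v * u) * (c * \<sigma> r d)" unfolding u(2) by (simp add: mult.assoc)
      finally show "a * b \<in> rmul W (c * \<sigma> r d)" using mult_in_W[OF v(1) u(1)] by (auto simp: rmul_def)
    qed (simp add: add_subgroup_rmul add_W)
    show "rmul W (c * \<sigma> r d) \<subseteq> rmul W c \<odot> \<sigma> r ` rmul W d"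
    proof
      fix x assume "x \<in> rmul W (c * \<sigma> r d)"
      then obtain w where w: "w \<in> W" "x = (w * c) * \<sigma> r (1 * d)" by (auto simp: rmul_def mult.assoc)
      show "x \<in> rmul W c \<odot> \<sigma> r ` rmul W d"
        unfolding w(2) by (intro set_prod_mem imageI) (use w one_in_W in \<open>unfold rmul_def, blast+\<close>)
    qed
  qed
qed

lemma rmul_minus:
  assumes g: "c \<noteq> 0" "sandwiched (hom c s)" and h: "d \<noteq> 0" "sandwiched (hom d (- s))"
  shows "rmul W d = rmul W (\<sigma> (- s) (inverse c))"
  using sandwiched_unique[OF h(2) sandwiched_inv[OF g(2)]] g h
  by (simp add: hinv_hom assoc_eq_hom_iff)

lemma companion_family_extension:
  assumes c: "\<And>s. s \<in> sandwich_degrees \<Longrightarrow> c s \<noteq> 0 \<and> sandwiched (hom (c s) s)"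
  shows "graded_extension \<sigma> V UNIV (companion_family sandwich_degrees c V A)"
proof -
  have UNIV: "add_subgroup (UNIV :: rat set)" by (simp add: add_subgroup_def)
  have homs: "homs (companion_family sandwich_degrees c V A) = companion sandwich_degrees (\<lambda>s. hom (c s) s) (homs A)"
    using c A_0 by (intro homs_companion_family) auto
  have "add_subgroup (companion_family sandwich_degrees c V A r)" for r
    using A_subgroup[of 0] A_subgroup[of r] A_0 by (auto simp: companion_family_def add_subgroup_rmul add_J add_W)
  moreover have "companion_family sandwich_degrees c V A 0 = V" by (simp add: companion_family_def)
  ultimately show ?thesis
    unfolding graded_extension_iff[OF UNIV] homs
    using companion_cone[of "\<lambda>s. hom (c s) s"] c by auto
qed

lemma graded_extension_restrict:
  assumes "add_subgroup G" shows "graded_extension \<sigma> V G A"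
  unfolding graded_extension_iff[OF assms] using A_subgroup A_0 mult_P total_P by auto

end


context graded_family
begin

text \<open>
  The generators $c_s$ are arbitrary: any $c$ with ${}^*(J(W) A_s) = W c$ is sandwiched, and all
  required relations hold for sandwiched elements.
\<close>

lemma type_h_imp_structure:
  assumes h: "graded_extension_type_h \<sigma> V A" and H: "H = {r. \<exists>c. star (J \<odot> A r) = rmul W c}"
  obtains c where
    "\<And>s. s \<in> H \<Longrightarrow> c s \<noteq> 0"
    "\<And>s. s \<in> H \<Longrightarrow> star (J \<odot> A s) = rmul W (c s)"
    "\<And>s. s \<in> H \<Longrightarrow> rmul W (c s) = lmul (c s) (\<sigma> s ` W)"
    "\<And>s. s \<in> H \<Longrightarrow> rmul W (c (- s)) = rmul W (\<sigma> (- s) (inverse (c s)))"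
    "\<And>r s. r \<in> H \<Longrightarrow> s \<in> H \<Longrightarrow> rmul W (c r) \<odot> \<sigma> r ` rmul W (c s) = rmul W (c (r + s))"
    "H \<noteq> {0}" "H \<noteq> UNIV" "add_subgroup H" "graded_extension \<sigma> V H A"
    "\<And>s. s \<notin> H \<Longrightarrow> star (A s) = A s \<and> A s = W \<odot> A s \<and> (\<nexists>d. A s = rmul W d) \<and> right_order (A s) = \<sigma> s ` W"
    "graded_extension \<sigma> V UNIV (companion_family H c V A)"
proof -
  have ge: "graded_extension \<sigma> V UNIV A" using h by (simp add: graded_extension_type_h_def)
  interpret graded_extension_family \<sigma> W V A by unfold_locales (rule ge)
  obtain G where II: "graded_extension_type_II \<sigma> V G A" using h by (auto simp: graded_extension_type_h_def)
  have ne: "W \<noteq> UNIV" by (rule type_II_W_proper[OF II])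
  have H': "H = sandwich_degrees" using H star_degrees[OF ne] by simp
  define c where "c s = (SOME c. star (J \<odot> A s) = rmul W c)" for s
  have st: "star (J \<odot> A s) = rmul W (c s)" if "s \<in> H" for s
    using that someI_ex[of "\<lambda>c. star (J \<odot> A s) = rmul W c"] unfolding c_def H by blast
  have c: "c s \<noteq> 0" "sandwiched (hom (c s) s)" if "s \<in> H" for s
    using sandwiched_of_star[OF ne st[OF that]] by blast+
  have sub: "add_subgroup H" unfolding H' by (rule sandwich_degrees_subgroup)
  show ?thesis
  proof (rule that)
    show "rmul W (c s) = lmul (c s) (\<sigma> s ` W)" if "s \<in> H" for s
      using sandwiched_normalizes[OF c(2)[OF that]] c(1)[OF that] by (simp add: normalizes_W_hom_iff)
    show "rmul W (c (- s)) = rmul W (\<sigma> (- s) (inverse (c s)))" if "s \<in> H" for s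
      using rmul_minus c that add_subgroup_minus[OF sub that] by blast
    show "rmul W (c r) \<odot> \<sigma> r ` rmul W (c s) = rmul W (c (r + s))" if "r \<in> H" "s \<in> H" for r s
      using rmul_product c that add_subgroup_add[OF sub that] by blast
    show "graded_extension \<sigma> V UNIV (companion_family H c V A)"
      unfolding H' using companion_family_extension c H' by blast
    show "H \<noteq> {0}" "H \<noteq> UNIV" using type_II_sandwich_degrees[OF II] H' by auto
    show "graded_extension \<sigma> V H A" by (rule graded_extension_restrict[OF sub])
  qed (use c st sub off_sandwich_degrees[OF ne] H' in auto)
qed

text \<open>
  Ring structure: $B$ determines the family on $H$, where totality of $B$ gives the lower bounds
  $J(W) c_s \<subseteq> A_s$, and $M$ is a cone, so that the rest follows by transfer.
  
  Type (II): take $0 < s \<in> H$ and write $s = a + b$ with $a, b > 0$ outside $H$. Then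
  $A_a A_b^{\<sigma>(a)} \<subseteq> J(W) c_s$ and similarly in degree $-s$. Both products cannot fill their
  components, since by totality of $B$ either $c_s \<in> A_s$ or $c_s^{-1}$, twisted, lies in $A_{-s}$.
\<close>

lemma structure_imp_type_h:
  assumes c: "\<And>s. s \<in> H \<Longrightarrow> c s \<noteq> 0"
    and st: "\<And>s. s \<in> H \<Longrightarrow> star (J \<odot> A s) = rmul W (c s)"
    and norm: "\<And>s. s \<in> H \<Longrightarrow> rmul W (c s) = lmul (c s) (\<sigma> s ` W)"
    and minus: "\<And>s. s \<in> H \<Longrightarrow> rmul W (c (- s)) = rmul W (\<sigma> (- s) (inverse (c s)))"
    and H: "H \<noteq> {0}" "H \<noteq> UNIV" "add_subgroup H" and B: "graded_extension \<sigma> V H A"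
    and off: "\<And>s. s \<notin> H \<Longrightarrow> A s = W \<odot> A s \<and> (\<nexists>d. A s = rmul W d) \<and> right_order (A s) = \<sigma> s ` W"
    and M: "graded_extension \<sigma> V UNIV (companion_family H c V A)"
  shows "graded_extension_type_h \<sigma> V A"
proof -
  let ?g = "\<lambda>s. hom (c s) s" and ?Q = "homs A"
  let ?M = "companion H ?g ?Q"
  have UNIV: "add_subgroup (UNIV :: rat set)" by (simp add: add_subgroup_def)
  have M_homs: "homs (companion_family H c V A) = ?M" by (rule homs_companion_family) (use c A_0 in auto)
  have mult_M: "hmult x y \<in> ?M" if "x \<in> ?M" "y \<in> ?M" for x y
    using M that unfolding graded_extension_iff[OF UNIV] M_homs by blast
  have total_M: "x \<in> ?M \<or> hinv x \<in> ?M" for x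
    using M unfolding graded_extension_iff[OF UNIV] M_homs by blast
  have mult_B: "hmult x y \<in> ?Q" if "x \<in> ?Q" "y \<in> ?Q" "hdeg x \<in> H" "hdeg y \<in> H" for x y
    using B that unfolding graded_extension_iff[OF H(3)] by blast
  have total_B: "x \<in> ?Q \<or> hinv x \<in> ?Q" if "hdeg x \<in> H" for x
    using B that unfolding graded_extension_iff[OF H(3)] by blast
  have Hm: "- s \<in> H" if "s \<in> H" for s by (rule add_subgroup_minus[OF H(3) that])
  have deg_g: "hdeg (?g s) = s" if "s \<in> H" for s using c that by simp
  have norm_g: "normalizes_W (?g s)" if "s \<in> H" for s
    using normalizes_W_hom_iff[OF c[OF that]] norm[OF that] by simp
  have upper: "hmult x (hinv (?g s)) \<in> homW" if s: "s \<in> H" and x: "x \<in> ?Q" "hdeg x = s" for s x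
  proof (cases x)
    fix a r assume a: "a \<noteq> 0" "x = hom a r"
    then have "a \<in> A s" "r = s" using x by (auto simp: hom_in_homs)
    then have "a \<in> rmul W (c s)" using star_upper[OF st[OF s] c[OF s]] by blast
    then show ?thesis using a c[OF s] \<open>r = s\<close> by (simp add: quotient_hom hom_in_homW mem_rmul_iff)
  qed
  have inverse_g: "hmult (?g (- s)) (?g s) \<in> homW" if s: "s \<in> H" for s
  proof -
    have "assoc_eq (?g (- s)) (hom (\<sigma> (- s) (inverse (c s))) (- s))"
      using minus[OF s] c[OF s] c[OF Hm[OF s]] by (subst assoc_eq_hom_iff) simp_all
    also have "hom (\<sigma> (- s) (inverse (c s))) (- s) = hinv (?g s)"
      using c[OF s] by (simp add: hinv_hom)
    finally show ?thesis by (simp add: assoc_eq_def)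
  qed
  have sandwich_Q: "sandwich ?Q (?g s)" if s: "s \<in> H" for s
  proof (rule sandwich_if_total[where h = "?g (- s)"])
    show "x \<in> ?Q \<or> hinv x \<in> ?Q" if "hdeg x = hdeg (?g s)" for x using total_B that deg_g s by simp
  qed (use norm_g inverse_g upper deg_g Hm s in auto)
  have sandwich_M: "sandwich ?M (?g s)" if "s \<in> H" for s
    using companion_sandwich[of ?Q ?g s H] sandwich_Q deg_g that by blast
  have off_M: "x \<in> ?Q \<longleftrightarrow> x \<in> ?M" if "hdeg x \<notin> H" for x using that by (simp add: companion_def)
  have stable_A: "w * x \<in> A s" "x * \<sigma> s w \<in> A s" if "s \<notin> H" "w \<in> W" "x \<in> A s" for s w x
  proof -
    have "W \<odot> A s \<subseteq> A s" using off[OF that(1)] by auto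
    then show "w * x \<in> A s" using set_prod_mem[OF that(2,3)] by blast
    have "\<sigma> s w \<in> right_order (A s)" using off[OF that(1)] that(2) by blast
    then show "x * \<sigma> s w \<in> A s" using that(3) by (auto simp: right_order_def rmul_def)
  qed
  have stable: "hmult w x \<in> ?M \<and> hmult x w \<in> ?M" if "x \<in> ?M" "hdeg x \<notin> H" "w \<in> homW" for x w
  proof (cases w; cases x)
    fix a r b s assume a: "a \<noteq> 0" "w = hom a r" and b: "b \<noteq> 0" "x = hom b s"
    have x: "x \<in> ?Q" using off_M that by blast
    then have "hmult w x \<in> ?Q \<and> hmult x w \<in> ?Q"
      using stable_A[of s a b] a b that by (simp add: hmult_hom hom_in_homs hom_in_homW)
    moreover have "hdeg (hmult w x) \<notin> H" "hdeg (hmult x w) \<notin> H" using that by (simp_all add: deg_W)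
    ultimately show ?thesis using off_M by blast
  qed
  have not_principal_M: "\<exists>x'\<in>?M. hdeg x' = hdeg x \<and> hmult x' (hinv x) \<notin> homW" if "x \<in> ?M" "hdeg x \<notin> H" for x
  proof (cases x)
    fix a s assume a: "a \<noteq> 0" "x = hom a s"
    then have s: "s \<notin> H" "a \<in> A s" using that off_M[of x] by (auto simp: hom_in_homs)
    then have "rmul W a \<subseteq> A s" using stable_A by (auto simp: rmul_def)
    then obtain b where b: "b \<in> A s" "b \<notin> rmul W a" using off[OF s(1)] by blast
    then have "b \<noteq> 0" using a by (auto simp: mem_rmul_iff)
    then show ?thesis using a b s off_M[of "hom b s"]
      by (intro bexI[of _ "hom b s"]) (simp_all add: quotient_hom hom_in_homW hom_in_homs mem_rmul_iff)
  qed
  have degree_0: "x \<in> homW" if "x \<in> ?M" "hdeg x = 0" for x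
    using that homs_degree_0[of x] by (simp add: companion_def)
  have g: "hdeg (?g s) = s \<and> normalizes_W (?g s) \<and> sandwich ?M (?g s) \<and> sandwich ?Q (?g s)" if "s \<in> H" for s
    using deg_g norm_g sandwich_M sandwich_Q that by blast
  note transfer = cone_transfer[where H = H and P = ?M and g = ?g and Q = ?Q,
      OF H(3) mult_M total_M degree_0 g off_M stable not_principal_M mult_B total_B]
  have ge: "graded_extension \<sigma> V UNIV A"
    unfolding graded_extension_iff[OF UNIV] using A_subgroup A_0 transfer by blast
  interpret graded_extension_family \<sigma> W V A by unfold_locales (rule ge)
  obtain h where h: "h \<in> H" "h > 0"
  proof -
    obtain h where "h \<in> H" "h \<noteq> 0" using H by (auto simp: add_subgroup_def)
    then show ?thesis using that[of h] that[of "- h"] Hm by (cases "h > 0") auto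
  qed
  obtain a where a: "a \<notin> H" "a > 0"
  proof -
    obtain a where a: "a \<notin> H" using H by blast
    then have "a \<noteq> 0" "- a \<notin> H" using H(3) Hm[of "- a"] by (auto simp: add_subgroup_def)
    then show ?thesis using a that[of a] that[of "- a"] by (cases "a > 0") auto
  qed
  \<comment> \<open>A large multiple of $h$ leaves room for a positive $b$.\<close>
  obtain n where "a < of_nat n * h" using ex_less_of_nat_mult[OF h(2)] by blast
  moreover define s where "s = of_nat n * h"
  moreover define b where "b = s - a"
  moreover have s: "s \<in> H" unfolding s_def by (rule add_subgroup_of_nat_mult[OF H(3) h(1)])
  ultimately have b: "b > 0" "a + b = s" by simp_all
  have bH: "b \<notin> H"
  proof
    assume "b \<in> H"
    then have "s - b \<in> H" using H(3) s by (simp add: add_subgroup_def)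
    moreover have "s - b = a" using b(2) by linarith
    ultimately show False using a by simp
  qed
  have products: "A x \<odot> \<sigma> x ` A y \<subseteq> rmul J (c (x + y))" if xy: "x \<notin> H" "y \<notin> H" "x + y \<in> H" for x y
  proof (rule set_prod_subset)
    fix u v assume "u \<in> A x" "v \<in> \<sigma> x ` A y"
    then obtain w where w: "w \<in> A y" "v = \<sigma> x w" by blast
    show "u * v \<in> rmul J (c (x + y))"
    proof (cases "u = 0 \<or> w = 0")
      case False
      have u: "hom u x \<in> ?Q" "hom w y \<in> ?Q" using False w \<open>u \<in> A x\<close> by (simp_all add: hom_in_homs)
      have dx: "hdeg (hom u x) = x" "hdeg (hom w y) = y" using False by simp_all
      have nH: "hdeg (hom u x) \<notin> H" unfolding dx by (rule xy(1))
      have uM: "hom u x \<in> ?M" by (rule off_M[THEN iffD1, OF nH u(1)])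
      obtain x' where x': "x' \<in> ?M" "hdeg x' = hdeg (hom u x)" "hmult x' (hinv (hom u x)) \<notin> homW"
        by (rule bexE[OF not_principal_M[OF uM nH]], elim conjE) (rule that)
      have "hdeg x' \<notin> H" using x'(2) nH by simp
      then have "x' \<in> ?Q" by (rule off_M[THEN iffD2, OF _ x'(1)])
      then have "\<exists>x'\<in>?Q. hdeg x' = hdeg (hom u x) \<and> hmult x' (hinv (hom u x)) \<notin> homW"
        using x'(2,3) by (intro bexI conjI)
      moreover have "hdeg (?g (x + y)) = hdeg (hom u x) + hdeg (hom w y)"
        unfolding dx by (rule deg_g[OF xy(3)])
      ultimately have "hmult (hmult (hom u x) (hom w y)) (hinv (?g (x + y))) \<in> rad"
        using u sandwich_Q[OF xy(3)] mult_P by (intro product_in_rad[where P = ?Q])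
      moreover have "hmult (hom u x) (hom w y) = hom (u * \<sigma> x w) (x + y)"
        using False by (simp add: hmult_hom)
      ultimately have "hmult (hom (u * \<sigma> x w) (x + y)) (hinv (?g (x + y))) \<in> rad" by (simp only:)
      then show ?thesis using False w c[OF xy(3)] by (simp add: quotient_hom hom_in_rad mem_rmul_iff)
    qed (use w c[OF xy(3)] in \<open>auto simp: mem_rmul_iff mem_J_iff\<close>)
  qed (simp add: add_subgroup_rmul add_J)
  have not_both: "\<not> (A a \<odot> \<sigma> a ` A b = A s \<and> A (- a) \<odot> \<sigma> (- a) ` A (- b) = A (- s))"
  proof
    assume "A a \<odot> \<sigma> a ` A b = A s \<and> A (- a) \<odot> \<sigma> (- a) ` A (- b) = A (- s)"
    then have eq: "A s = A a \<odot> \<sigma> a ` A b" "A (- s) = A (- a) \<odot> \<sigma> (- a) ` A (- b)" by simp_all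
    have 1: "A s \<subseteq> rmul J (c s)"
      using products[OF a(1) bH] b(2) s unfolding eq by simp
    have "- a \<notin> H" "- b \<notin> H" "- a + - b = - s"
      using a(1) bH Hm[of "- a"] Hm[of "- b"] b(2) by auto
    then have 2: "A (- s) \<subseteq> rmul J (c (- s))"
      using products[of "- a" "- b"] Hm[OF s] unfolding eq by metis
    have "c s \<notin> A s"
      using 1 c[OF s] by (auto simp: mem_rmul_iff mem_J_iff)
    then have "hinv (?g s) \<in> ?Q" using total_B[of "?g s"] c[OF s] s by (simp add: hom_in_homs)
    then have "inverse (\<sigma> (- s) (c s)) \<in> rmul J (c (- s))" using 2 c[OF s] by (auto simp: hinv_hom hom_in_homs)
    then have "hmult (hinv (?g s)) (hinv (?g (- s))) \<in> rad"
      using c[OF s] c[OF Hm[OF s]] by (simp add: hinv_hom[of "c s"] quotient_hom hom_in_rad mem_rmul_iff)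
    then show False using inverse_g[OF s] by (simp add: rad_def)
  qed
  have II: "A a \<odot> \<sigma> a ` A b \<noteq> A (a + b) \<or> A (- a) \<odot> \<sigma> (- a) ` A (- b) \<noteq> A (- a - b)"
  proof -
    have minus: "- a - b = - s" using b(2) by linarith
    show ?thesis unfolding minus b(2) using not_both by blast
  qed
  obtain r i j where r: "r > 0" "a = of_int i * r" "b = of_int j * r" by (rule rat_common_unit)
  let ?G = "range (\<lambda>i::int. of_int i * r)"
  have "add_subgroup ?G"
    unfolding add_subgroup_def
  proof (intro conjI ballI)
    show "0 \<in> ?G" by (rule image_eqI[of _ _ 0]) simp_all
    fix x y assume "x \<in> ?G" "y \<in> ?G"
    then obtain i j :: int where "x = of_int i * r" "y = of_int j * r" by blast
    then have "x - y = of_int (i - j) * r" by (simp add: left_diff_distrib)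
    then show "x - y \<in> ?G" by blast
  qed
  then have "graded_extension \<sigma> V ?G A" by (rule graded_extension_restrict)
  moreover have "a \<in> ?G" "b \<in> ?G" using r by auto
  ultimately have "graded_extension_type_II \<sigma> V ?G A"
    unfolding graded_extension_type_II_def using II a(2) b(1) by blast
  then show ?thesis
    unfolding graded_extension_type_h_def Let_def W_eq_Union[symmetric] using ge r(1) idempotent by blast
qed

end

theorem theorem4p22:
  fixes \<sigma> :: "rat \<Rightarrow> 'a::division_ring \<Rightarrow> 'a"
    and V W :: "'a set"
    and A :: "rat \<Rightarrow> 'a set"
    and H :: "rat set"
  assumes "aut_action \<sigma>"
    and "total_valuation_ring V" and "V \<noteq> UNIV"
    and "add_subgroup (graded_sum UNIV A)" and "A 0 = V"
    and "W = (\<Union>r. left_order (A r))"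
    and "total_valuation_ring W" and "V \<subset> W"
    and "jacobson W \<odot> jacobson W = jacobson W"
    and "\<exists>t. left_order (A t) = W"
    and "H = {r. \<exists>c. star (jacobson W \<odot> A r) = rmul W c}"
  shows "graded_extension_type_h \<sigma> V A \<longleftrightarrow>
    (\<exists>c :: rat \<Rightarrow> 'a.
       (\<forall>s\<in>H. c s \<noteq> 0) \<and>
       (\<forall>r\<in>H. \<forall>s\<in>H.
          star (jacobson W \<odot> A s) = rmul W (c s) \<and>
          rmul W (c s) = lmul (c s) (\<sigma> s ` W) \<and>
          rmul W (c (- s)) = rmul W (\<sigma> (- s) (inverse (c s))) \<and>
          rmul W (c r) \<odot> \<sigma> r ` rmul W (c s) = rmul W (c (r + s))) \<and>
       (H \<noteq> {0} \<and> H \<noteq> UNIV \<and> add_subgroup H \<and> graded_extension \<sigma> V H A) \<and>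
       (\<forall>s. s \<notin> H \<longrightarrow>
          star (A s) = A s \<and> A s = W \<odot> A s \<and>
          (\<nexists>d. A s = rmul W d) \<and>
          right_order (A s) = \<sigma> s ` W) \<and>
       graded_extension \<sigma> V UNIV
         (\<lambda>r. if r = 0 then V
              else if r \<in> H then (if r < 0 then rmul W (c r) else rmul (jacobson W) (c r))
              else A r))"
    (is "_ \<longleftrightarrow> ?R")
proof -
  have A_subgroup: "add_subgroup (A r)" for r
  proof -
    have "0 \<in> graded_sum UNIV A" using assms(4) by (simp add: add_subgroup_def)
    then have zero: "0 \<in> A s" for s by (simp add: graded_sum_def)
    have single: "Poly_Mapping.single r a \<in> graded_sum UNIV A \<longleftrightarrow> a \<in> A r" for a
      using zero by (auto simp: graded_sum_def skew_group_ring_def lookup_single when_def)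
    have "a - b \<in> A r" if ab: "a \<in> A r" "b \<in> A r" for a b
    proof -
      have "Poly_Mapping.single r a - Poly_Mapping.single r b \<in> graded_sum UNIV A"
        using ab assms(4) single unfolding add_subgroup_def by blast
      then show ?thesis using single[of "a - b"] by (simp add: single_diff)
    qed
    with zero show ?thesis by (simp add: add_subgroup_def)
  qed
  interpret graded_family \<sigma> W V A
    by unfold_locales (fact assms A_subgroup)+
  show ?thesis
  proof
    assume h: "graded_extension_type_h \<sigma> V A"
    show ?R
    proof (rule type_h_imp_structure[OF h assms(11)], goal_cases)
      case (1 c)
      show ?R
      proof (rule exI[of _ c], intro conjI ballI allI impI)
        show "graded_extension \<sigma> V UNIV (\<lambda>r. if r = 0 then V
            else if r \<in> H then (if r < 0 then rmul W (c r) else rmul J (c r)) else A r)"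
          using 1(11) unfolding companion_family_def .
      qed ((rule 1; assumption) | (drule 1(10); elim conjE; assumption))+
    qed
  next
    assume ?R
    then obtain c where c: "\<forall>s\<in>H. c s \<noteq> 0"
      and eqs: "\<forall>r\<in>H. \<forall>s\<in>H. star (J \<odot> A s) = rmul W (c s) \<and> rmul W (c s) = lmul (c s) (\<sigma> s ` W) \<and>
          rmul W (c (- s)) = rmul W (\<sigma> (- s) (inverse (c s))) \<and>
          rmul W (c r) \<odot> \<sigma> r ` rmul W (c s) = rmul W (c (r + s))"
      and H: "H \<noteq> {0}" "H \<noteq> UNIV" "add_subgroup H" "graded_extension \<sigma> V H A"
      and off: "\<forall>s. s \<notin> H \<longrightarrow> star (A s) = A s \<and> A s = W \<odot> A s \<and> (\<nexists>d. A s = rmul W d) \<and> right_order (A s) = \<sigma> s ` W"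
      and M: "graded_extension \<sigma> V UNIV (\<lambda>r. if r = 0 then V
            else if r \<in> H then (if r < 0 then rmul W (c r) else rmul J (c r)) else A r)"
      by (elim exE conjE) (rule that)
    show "graded_extension_type_h \<sigma> V A"
      by (rule structure_imp_type_h[OF _ _ _ _ H _ M[folded companion_family_def]])
        (use c eqs off in blast)+
  qed
qed

end
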